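(* There is an absolute constant $c>0$ such that the following holds. For every $n \in \mathbb{N}$, every matroid $\mathcal{M} \subseteq 2^{[n]}$ and every positive integer $k$, there is an online algorithm for the secretary problem with feasibility constraint $\mathcal{M}^k$ that is $\bigl(1-c\sqrt{\log(n)/k}\bigr)$-competitive.
   Context: Matroids are identified with their families of independent sets: a matroid on $N=[n]$ is a family $\mathcal{M}\subseteq 2^N$ containing $\emptyset$, closed downward, and satisfying augmentation (if $S,T\in\mathcal{M}$ and $|S|<|T|$, there is $i\in T\setminus S$ with $S\cup\{i\}\in\mathcal{M}$). For matroids $\mathcal{M}_1,\dots,\mathcal{M}_k$ on $N$, the union $\mathcal{M}_1\lor\dots\lor\mathcal{M}_k$ is the matroid consisting of all $S$ that can be partitioned into $S_1,\dots,S_k$ with $S_\ell\in\mathcal{M}_\ell$ for all $\ell$. The $k$-fold union is $\mathcal{M}^k=\bigvee_{i\in[k]}\mathcal{M}$. Secretary problem with feasibility constraint $\mathcal{F}\subseteq 2^N$: the elements of $N=[n]$ have distinct nonnegative weights, unknown in advance, while $\mathcal{F}$ is known in advance. The elements arrive one at a time in uniformly random order. When element $i$ arrives its weight is revealed, and the algorithm must irrevocably accept or reject it, and may accept it only if $\mathrm{ALG}\cup\{i\}\in\mathcal{F}$, where $\mathrm{ALG}$ is the set accepted so far. For $S\subseteq N$, $w(S)$ is the sum of the weights of its elements. An algorithm is $\alpha$-competitive if, for every weight assignment, $\mathbb{E}[w(\mathrm{ALG})]\ge \alpha\cdot\max_{S\in\mathcal{F}}w(S)$, where the expectation is over the random arrival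 order and the algorithm's internal randomness. *)

theory Defs
  imports Complex_Main
begin

definition matroid :: "nat \<Rightarrow> nat set set \<Rightarrow> bool" where
  "matroid n M \<longleftrightarrow>
     M \<subseteq> Pow {..<n} \<and> {} \<in> M \<and>
     (\<forall>S T. T \<in> M \<longrightarrow> S \<subseteq> T \<longrightarrow> S \<in> M) \<and>
     (\<forall>S T. S \<in> M \<longrightarrow> T \<in> M \<longrightarrow> card S < card T \<longrightarrow>
        (\<exists>i \<in> T - S. insert i S \<in> M))"

definition matroid_union_pow :: "nat set set \<Rightarrow> nat \<Rightarrow> nat set set" where
  "matroid_union_pow M k =
     {S. \<exists>P :: nat \<Rightarrow> nat set. (\<forall>l<k. P l \<in> M) \<and> (\<Union>l<k. P l) = S \<and>
          (\<forall>l<k. \<forall>l'<k. l \<noteq> l' \<longrightarrow> P l \<inter> P l' = {})}"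

text \<open>A (randomized) online algorithm is given as a behavioural strategy: given the
  history of arrivals so far (element, revealed weight), the last entry being the current
  element, and the set accepted so far, it returns the probability of accepting the current
  element. Acceptance is only carried out when it keeps the accepted set feasible.\<close>
type_synonym online_alg = "(nat \<times> real) list \<Rightarrow> nat set \<Rightarrow> real"

definition valid_alg :: "online_alg \<Rightarrow> bool" where
  "valid_alg A \<longleftrightarrow> (\<forall>h S. 0 \<le> A h S \<and> A h S \<le> 1)"

fun run :: "online_alg \<Rightarrow> nat set set \<Rightarrow> (nat \<Rightarrow> real) \<Rightarrow> (nat \<times> real) list \<Rightarrow> nat set
             \<Rightarrow> nat list \<Rightarrow> real" where
  "run A F w h S [] = 0"
| "run A F w h S (i # rest) =
     (let h' = h @ [(i, w i)];
          q = (if insert i S \<in> F then A h' S else 0)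
      in q * (w i + run A F w h' (insert i S) rest) + (1 - q) * run A F w h' S rest)"

definition expected_alg :: "nat \<Rightarrow> online_alg \<Rightarrow> nat set set \<Rightarrow> (nat \<Rightarrow> real) \<Rightarrow> real" where
  "expected_alg n A F w =
     (\<Sum>\<sigma>\<in>{xs. distinct xs \<and> set xs = {..<n}}. run A F w [] {} \<sigma>) / fact n"

definition opt :: "nat set set \<Rightarrow> (nat \<Rightarrow> real) \<Rightarrow> real" where
  "opt F w = Max ((\<lambda>S. sum w S) ` F)"

definition competitive :: "nat \<Rightarrow> real \<Rightarrow> online_alg \<Rightarrow> nat set set \<Rightarrow> bool" where
  "competitive n \<alpha> A F \<longleftrightarrow>
     (\<forall>w :: nat \<Rightarrow> real. inj_on w {..<n} \<longrightarrow> (\<forall>i<n. 0 \<le> w i) \<longrightarrow>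
        expected_alg n A F w \<ge> \<alpha> * opt F w)"

end

theory Submission
  imports Defs "HOL-Combinatorics.Multiset_Permutations"
begin

text \<open>
  Put \<open>\<epsilon> = 4 \<surd>(ln n / k)\<close>. When the \<open>t\<close>-th element arrives, let \<open>B\<close> be a maximum-weight member of
  the \<open>\<lfloor>(1 - \<epsilon>) k t / n\<rfloor>\<close>-fold union among the \<open>t\<close> elements seen, and accept the element if it lies
  in \<open>B\<close>. By the matroid covering theorem, a set is in the \<open>k\<close>-fold union iff it contains at most
  \<open>k |J|\<close> elements of the closure of each independent \<open>J\<close>. Revealing the order backwards,
  an element of that closure is accepted at each step with conditional probability at most
  \<open>(1 - \<epsilon>) k |J| / n\<close>, so overflow has probability at most \<open>exp (- \<epsilon>\<^sup>2 k |J| / 4) = n\<close> to the power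
  \<open>- 4 |J|\<close>, which is small enough to sum over all \<open>J\<close>: the number of \<open>J\<close> of size \<open>r\<close> is at most \<open>n\<close> to
  the power \<open>r\<close>. This is why the loss is logarithmic in \<open>n\<close> although there are exponentially many
  constraints.

  For the value, drop the lightest few of the \<open>k\<close> parts of an optimal solution. By the same union
  bound, the trace of the rest on a random \<open>t\<close>-subset is almost always a competitor of \<open>B\<close>, so
  \<open>B\<close> has expected weight about \<open>(t / n) (1 - 16 \<surd>(n ln n / (k t)))\<close> times the optimum; a
  \<open>1 / t\<close> fraction of it is collected at step \<open>t\<close>, and the losses sum to \<open>O(\<surd>(ln n / k))\<close>. For
  \<open>k \<ge> n\<close> all non-loops are accepted.
\<close>

section \<open>Matroid union powers\<close>

locale set_matroid =
  fixes n :: nat and M :: "nat set set"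
  assumes matroid: "matroid n M"
begin

section \<open>Closure, extension and exchange for independent sets\<close>

lemma indep_ground: "S \<in> M \<Longrightarrow> S \<subseteq> {..<n}"
  using matroid unfolding matroid_def by blast

lemma indep_finite: "S \<in> M \<Longrightarrow> finite S"
  using indep_ground finite_subset by blast

lemma indep_empty: "{} \<in> M"
  using matroid unfolding matroid_def by blast

lemma indep_subset: "T \<in> M \<Longrightarrow> S \<subseteq> T \<Longrightarrow> S \<in> M"
  using matroid unfolding matroid_def by metis

lemma indep_augment:
  assumes "S \<in> M" "T \<in> M" "card S < card T"
  obtains i where "i \<in> T - S" "insert i S \<in> M"
  using assms matroid unfolding matroid_def by metis

text \<open>This is the matroid closure only when \<open>J\<close> is independent.\<close>
definition cl :: "nat set \<Rightarrow> nat set" where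
  "cl J = {x \<in> {..<n}. x \<in> J \<or> insert x J \<notin> M}"

lemma cl_ground: "cl J \<subseteq> {..<n}"
  by (auto simp: cl_def)

lemma subset_cl: "J \<in> M \<Longrightarrow> J \<subseteq> cl J"
  using indep_ground by (auto simp: cl_def)

lemma cl_mono: "I \<subseteq> J \<Longrightarrow> cl I \<subseteq> cl J"
  unfolding cl_def using indep_subset[of "insert _ J" "insert _ I"] by blast

lemma indep_card_le_cl:
  assumes "J \<in> M" "X \<in> M" "X \<subseteq> cl J"
  shows "card X \<le> card J"
proof (rule ccontr)
  assume "\<not> ?thesis"
  then obtain i where "i \<in> X - J" "insert i J \<in> M"
    using indep_augment[OF assms(1,2)] by auto
  then show False using assms(3) by (auto simp: cl_def)
qed

text \<open>If some \<open>x\<close> of \<open>cl J\<close> escaped \<open>cl J'\<close>, then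
  \<open>insert x J'\<close> would be an independent subset of \<open>cl J\<close> with more than
  \<open>card J\<close> elements.\<close>

lemma cl_subset_cl:
  assumes "J \<in> M" "J' \<in> M" "card J = card J'" "J' \<subseteq> cl J"
  shows "cl J \<subseteq> cl J'"
proof
  fix x assume x: "x \<in> cl J"
  show "x \<in> cl J'"
  proof (rule ccontr)
    assume "x \<notin> cl J'"
    then have *: "insert x J' \<in> M" "x \<notin> J'" using x by (auto simp: cl_def)
    then have "card (insert x J') \<le> card J"
      using indep_card_le_cl[OF assms(1)] assms(4) x by auto
    then show False using * assms(3) indep_finite[OF assms(2)] by simp
  qed
qed

lemma cl_eqI:
  assumes "J \<in> M" "J' \<in> M" "card J = card J'" "J' \<subseteq> cl J"
  shows "cl J' = cl J"
  using cl_subset_cl[OF assms] cl_subset_cl[OF assms(2,1) assms(3)[symmetric]] subset_cl[OF assms(1)]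
  by blast

lemma indep_extend:
  assumes "I \<in> M" "K \<in> M" "card K \<le> card I"
  shows "\<exists>K'. K \<subseteq> K' \<and> K' \<subseteq> K \<union> I \<and> K' \<in> M \<and> card K' = card I"
  using assms(2,3)
proof (induction "card I - card K" arbitrary: K)
  case 0
  then show ?case by auto
next
  case (Suc d)
  then obtain i where i: "i \<in> I - K" "insert i K \<in> M"
    using indep_augment[of K I] assms(1) by (metis zero_less_Suc zero_less_diff)
  have "card (insert i K) = Suc (card K)"
    using i indep_finite[OF Suc.prems(1)] by simp
  then obtain K' where "insert i K \<subseteq> K'" "K' \<subseteq> insert i K \<union> I" "K' \<in> M" "card K' = card I"
    using Suc.hyps(1)[of "insert i K"] i(2) Suc.hyps(2) by (metis Suc_diff_Suc Suc_leI diff_Suc_1 zero_less_Suc zero_less_diff)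
  then show ?case using i(1) by (intro exI[of _ K']) auto
qed

text \<open>Extending \<open>insert e J\<close> from \<open>I\<close> to size \<open>card I\<close>
  gives an independent subset of \<open>insert e I\<close> that contains \<open>e\<close> and misses
  exactly one element \<open>f\<close> of \<open>I\<close>. As \<open>J\<close> is kept,
  \<open>f\<close> lies outside \<open>J\<close>; this control over the position of \<open>f\<close>
  is what the covering theorem needs.\<close>

lemma indep_exchange:
  assumes "I \<in> M" "J \<subseteq> I" "insert e J \<in> M" "insert e I \<notin> M"
  obtains f where "f \<in> I - J" "insert e (I - {f}) \<in> M"
proof -
  have fin: "finite I" using assms(1) indep_finite by auto
  have eI: "e \<notin> I" using assms(1,4) by (auto simp: insert_absorb)
  have "J \<noteq> I" using assms by auto
  then have "card J < card I" using assms(2) fin by (simp add: psubset_card_mono psubset_eq)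
  then have "card (insert e J) \<le> card I"
    using eI assms(2) fin by (metis card_insert_disjoint finite_subset subsetD Suc_leI)
  then obtain K where K: "insert e J \<subseteq> K" "K \<subseteq> insert e J \<union> I" "K \<in> M" "card K = card I"
    using indep_extend[OF assms(1,3)] by auto
  have Ke: "K = insert e (K \<inter> I)" using K(1,2) assms(2) by auto
  have "card (K \<inter> I) < card I"
    using Ke K(4) eI fin by (metis Int_iff card_insert_disjoint finite_Int lessI)
  then obtain f where f: "f \<in> I" "f \<notin> K" using fin
    by (metis Int_absorb1 less_irrefl subsetI)
  have "card (K \<inter> I) = card (I - {f})"
    using Ke K(4) eI fin f
    by (metis Int_iff card_Diff_singleton card_insert_disjoint diff_Suc_1 finite_Int)
  moreover have "K \<inter> I \<subseteq> I - {f}" using f by auto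
  ultimately have "K \<inter> I = I - {f}" using fin by (simp add: card_subset_eq)
  then have "insert e (I - {f}) \<in> M" using Ke K(3) by simp
  moreover have "f \<notin> J" using f K(1) by auto
  ultimately show ?thesis using that f by auto
qed

section \<open>The matroid covering theorem\<close>

abbreviation upow :: "nat \<Rightarrow> nat set set" where
  "upow k \<equiv> matroid_union_pow M k"

lemma upowI:
  assumes "\<And>l. l < k \<Longrightarrow> P l \<in> M" "(\<Union>l<k. P l) = S"
    "\<And>l l'. l < k \<Longrightarrow> l' < k \<Longrightarrow> l \<noteq> l' \<Longrightarrow> P l \<inter> P l' = {}"
  shows "S \<in> upow k"
  using assms unfolding matroid_union_pow_def by blast

lemma upowE:
  assumes "S \<in> upow k"
  obtains P where "\<And>l. l < k \<Longrightarrow> P l \<in> M" "S = (\<Union>l<k. P l)"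
    "\<And>l l'. l < k \<Longrightarrow> l' < k \<Longrightarrow> l \<noteq> l' \<Longrightarrow> P l \<inter> P l' = {}"
  using assms unfolding matroid_union_pow_def by blast

text \<open>The sets \<open>A l\<close> are the layers of the Greene--Magnanti proof of the matroid covering theorem;
  an exchange moves the uncovered element to an earlier layer and leaves the layers up to there intact.\<close>
lemma upow_augment:
  assumes A0: "A 0 = {..<n}" and c: "\<And>l. c l < k"
    and I: "\<And>i. i < k \<Longrightarrow> I i \<in> M"
    and disj: "\<And>l l'. l < k \<Longrightarrow> l' < k \<Longrightarrow> l \<noteq> l' \<Longrightarrow> I l \<inter> I l' = {}"
    and A: "\<And>l. l \<le> j \<Longrightarrow> A (Suc l) = A l \<inter> cl (I (c l) \<inter> A l)"
    and e: "e \<in> A j" "e \<notin> A (Suc j)" "e \<notin> (\<Union>i<k. I i)"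
  shows "insert e (\<Union>i<k. I i) \<in> upow k"
  using I disj A e
proof (induction j arbitrary: I e rule: less_induct)
  case (less j)
  have anti: "A l' \<subseteq> A l" if "l \<le> l'" "l' \<le> Suc j" for l l'
    using that
  proof (induction l')
    case (Suc m)
    show ?case
    proof (cases "l \<le> m")
      case True
      then have "A m \<subseteq> A l" using Suc by auto
      moreover have "A (Suc m) \<subseteq> A m" using less.prems(3)[of m] Suc.prems by blast
      ultimately show ?thesis by blast
    next
      case False
      then have "l = Suc m" using Suc.prems by simp
      then show ?thesis by simp
    qed
  qed simp
  define i where "i = c j"
  have ik: "i < k" using c i_def by simp
  have Ii: "I i \<in> M" using less.prems(1) ik .
  have eI: "e \<notin> I i" using less.prems(6) ik by auto
  have en: "e \<in> {..<n}" using anti[of 0 j] A0 less.prems(4) by auto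
  have notQ: "e \<notin> cl (I i \<inter> A j)" using less.prems(3)[of j] less.prems(4,5) i_def by auto
  show ?case
  proof (cases "insert e (I i) \<in> M")
    case True
    show ?thesis
    proof (rule upowI[where P = "I(i := insert e (I i))"])
      show "(\<Union>l<k. (I(i := insert e (I i))) l) = insert e (\<Union>i<k. I i)"
        using ik by (auto split: if_splits)
    qed (use True less.prems(1,2,6) in \<open>auto split: if_splits\<close>)
  next
    case False
    \<comment> \<open>As \<open>A 0\<close> is the whole ground set, \<open>e\<close> is spanned by
      the trace of \<open>I i\<close> on layer \<open>0\<close>, but not by that on layer
      \<open>j\<close>. So spanning is lost between two consecutive layers \<open>m\<close> and
      \<open>Suc m\<close> with \<open>m < j\<close>.\<close>
    have "e \<in> cl (I i \<inter> A 0)"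
      using False A0 indep_ground[OF Ii] en by (simp add: cl_def Int_absorb2)
    moreover have "e \<in> cl (I i \<inter> A l)" if "l \<le> j" "e \<in> cl (I i \<inter> A 0)"
      "\<forall>m<j. e \<in> cl (I i \<inter> A m) \<longrightarrow> e \<in> cl (I i \<inter> A (Suc m))" for l
      using that by (induction l) auto
    ultimately obtain m where m: "m < j" "e \<in> cl (I i \<inter> A m)" "e \<notin> cl (I i \<inter> A (Suc m))"
      using notQ by blast
    have sub: "I i \<inter> X \<in> M" for X using Ii indep_subset by blast
    have dep: "insert e (I i \<inter> A m) \<notin> M" using m(2) eI by (auto simp: cl_def)
    have ind: "insert e (I i \<inter> A (Suc m)) \<in> M" using m(3) en by (auto simp: cl_def)
    have "I i \<inter> A (Suc m) \<subseteq> I i \<inter> A m" using anti[of m "Suc m"] m(1) by auto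
    then obtain f where f: "f \<in> I i" "f \<in> A m" "f \<notin> A (Suc m)" "insert e (I i \<inter> A m - {f}) \<in> M"
      using indep_exchange[OF sub _ ind dep] by blast
    \<comment> \<open>The first exchange found \<open>f\<close> within the trace on
      \<open>A m\<close>; this one works in all of \<open>I i\<close>. It must return the same
      \<open>f\<close>, since removing any other element would leave the dependent set
      \<open>insert e (I i \<inter> A m)\<close> inside an independent one.\<close>
    obtain g where g: "g \<in> I i - (I i \<inter> A m - {f})" "insert e (I i - {g}) \<in> M"
      using indep_exchange[OF Ii _ f(4) False] by blast
    have "g = f"
    proof (rule ccontr)
      assume "g \<noteq> f"
      then have "insert e (I i \<inter> A m) \<subseteq> insert e (I i - {g})" using g(1) by auto
      then show False using g(2) dep indep_subset by blast
    qed
    then have swap: "insert e (I i - {f}) \<in> M" using g by simp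
    have ef: "e \<noteq> f" using eI f by auto
    define I' where "I' = I(i := insert e (I i - {f}))"
    have un: "insert f (\<Union>i<k. I' i) = insert e (\<Union>i<k. I i)"
      using ik f(1) unfolding I'_def by (auto split: if_splits)
    have "insert f (\<Union>i<k. I' i) \<in> upow k"
    proof (rule less.IH[OF m(1)])
      show "I' l \<in> M" if "l < k" for l using swap less.prems(1) that by (simp add: I'_def)
      show "I' l \<inter> I' l' = {}" if "l < k" "l' < k" "l \<noteq> l'" for l l'
      proof -
        have "I l \<inter> I l' = {}" "e \<notin> I l" "e \<notin> I l'" using less.prems(2,6) that by auto
        then show ?thesis using that by (auto simp: I'_def)
      qed
      show "f \<in> A m" "f \<notin> A (Suc m)" by fact+
      show "f \<notin> (\<Union>i<k. I' i)"
      proof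
        assume "f \<in> (\<Union>i<k. I' i)"
        then obtain l where l: "l < k" "f \<in> I' l" by auto
        then have "l \<noteq> i" using ef by (auto simp: I'_def)
        then show False using l less.prems(2)[OF l(1) ik] f(1) by (auto simp: I'_def)
      qed
      show "A (Suc l) = A l \<inter> cl (I' (c l) \<inter> A l)" if "l \<le> m" for l
      proof (cases "c l = i")
        case True
        have fl: "f \<in> A l" "e \<in> A l" 
          using anti[of l m] anti[of l j] f(2) less.prems(4) that m(1) by auto
        have eq: "I' i \<inter> A l = insert e (I i \<inter> A l - {f})" using fl by (auto simp: I'_def)
        \<comment> \<open>Both \<open>e\<close> and \<open>f\<close> lie in \<open>A l\<close>, so
          the swap trades \<open>f\<close> for an element already spanned by the old trace. The size
          is unchanged, hence so is the closure.\<close>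
        have "cl (I' i \<inter> A l) = cl (I i \<inter> A l)"
        proof (rule cl_eqI[OF sub])
          show "I' i \<inter> A l \<in> M" using swap indep_subset by (auto simp: I'_def)
          have "finite (I i \<inter> A l)" using sub indep_finite by blast
          moreover have "f \<in> I i \<inter> A l" using fl f by simp
          ultimately show "card (I i \<inter> A l) = card (I' i \<inter> A l)"
            unfolding eq using eI by (simp add: card_Suc_Diff1 del: card_Diff_insert)
          have "e \<in> cl (I i \<inter> A l)"
            using m(2) cl_mono[of "I i \<inter> A m" "I i \<inter> A l"] anti[of l m] that m(1) by auto
          then show "I' i \<inter> A l \<subseteq> cl (I i \<inter> A l)"
            unfolding eq using subset_cl[OF sub[of "A l"]] by auto
        qed
        then show ?thesis using True less.prems(3)[of l] that m(1) by simp
      next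
        case False
        then show ?thesis using less.prems(3)[of l] that m(1) by (simp add: I'_def)
      qed
    qed
    then show ?thesis using un by simp
  qed
qed

text \<open>Layers shrink by passing to the span of a part that does not span the current layer. If
  \<open>e\<close> drops out at some layer, augmentation applies. Otherwise \<open>e\<close> lies in
  a layer \<open>X\<close> spanned by every part; all \<open>k\<close> traces on \<open>X\<close>
  then have the same size, and together with \<open>e\<close> they violate
  \<open>bound\<close>.\<close>

lemma upow_insert:
  assumes k: "0 < k" and S: "S \<in> upow k" and e: "e < n" "e \<notin> S"
    and bound: "\<And>J. J \<in> M \<Longrightarrow> card (insert e S \<inter> cl J) \<le> k * card J"
  shows "insert e S \<in> upow k"
proof -
  obtain I where I: "\<And>l. l < k \<Longrightarrow> I l \<in> M" and SI: "S = (\<Union>l<k. I l)"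
    and disj: "\<And>l l'. l < k \<Longrightarrow> l' < k \<Longrightarrow> l \<noteq> l' \<Longrightarrow> I l \<inter> I l' = {}"
    using upowE[OF S] by blast
  \<comment> \<open>The default \<open>0\<close> is a legal index because \<open>0 < k\<close>. It
    is reached only if every part spans \<open>X\<close>, and then the layer does not
    shrink.\<close>
  define ch where "ch X = (if \<exists>i<k. \<not> X \<subseteq> cl (I i \<inter> X) then SOME i. i < k \<and> \<not> X \<subseteq> cl (I i \<inter> X) else 0)" for X
  define A where "A = rec_nat {..<n} (\<lambda>_ X. X \<inter> cl (I (ch X) \<inter> X))"
  have A0: "A 0 = {..<n}" and AS: "A (Suc l) = A l \<inter> cl (I (ch (A l)) \<inter> A l)" for l
    by (simp_all add: A_def)
  have ch: "ch X < k \<and> ((\<exists>i<k. \<not> X \<subseteq> cl (I i \<inter> X)) \<longrightarrow> \<not> X \<subseteq> cl (I (ch X) \<inter> X))" for X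
    using someI_ex[of "\<lambda>i. i < k \<and> \<not> X \<subseteq> cl (I i \<inter> X)"] k unfolding ch_def by auto
  show ?thesis
  proof (cases "\<forall>l. e \<in> A l")
    case False
    then obtain j where j: "e \<in> A j" "e \<notin> A (Suc j)"
      using e(1) A0 nat_induct[of "\<lambda>l. e \<in> A l"] by auto
    show ?thesis unfolding SI
      by (rule upow_augment[where A = A and c = "\<lambda>l. ch (A l)" and j = j])
        (use A0 AS ch I disj j e SI in auto)
  next
    case True
    have fin: "finite (A l)" for l
      by (induction l) (auto simp: A0 AS)
    have "\<exists>l. A (Suc l) = A l"
    proof (rule ccontr)
      assume "\<not> ?thesis"
      then have dec: "card (A (Suc l)) < card (A l)" for l
        using AS fin by (intro psubset_card_mono) auto
      have "card (A l) + l \<le> n" for l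
      proof (induction l)
        case (Suc l)
        then show ?case using dec[of l] by linarith
      qed (simp add: A0)
      from this[of "Suc n"] show False by simp
    qed
    then obtain l where "A (Suc l) = A l" by blast
    then have "A l \<subseteq> cl (I (ch (A l)) \<inter> A l)" using AS[of l] by blast
    then have stable: "A l \<subseteq> cl (I i \<inter> A l)" if "i < k" for i
      using ch[of "A l"] that by blast
    define X where "X = A l"
    have X: "X \<subseteq> cl (I i \<inter> X)" "I i \<inter> X \<in> M" if "i < k" for i
      using stable[OF that] I[OF that] indep_subset unfolding X_def by blast+
    \<comment> \<open>Each trace is independent and lies in the closure of the other.\<close>
    have cards: "card (I i \<inter> X) = card (I 0 \<inter> X)" if "i < k" for i
      using indep_card_le_cl[OF X(2)[OF that] X(2)[OF k]] indep_card_le_cl[OF X(2)[OF k] X(2)[OF that]]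
        X(1)[OF that] X(1)[OF k] by (intro antisym) blast+
    have finX: "finite X" using fin X_def by simp
    have "insert e S \<inter> X = insert e (\<Union>i<k. I i \<inter> X)" using True SI X_def by auto
    then have "card (insert e S \<inter> X) = Suc (card (\<Union>i<k. I i \<inter> X))"
      using e(2) SI finX by simp
    also have "card (\<Union>i<k. I i \<inter> X) = (\<Sum>i<k. card (I i \<inter> X))"
      by (rule card_UN_disjoint) (use finX disj in auto)
    also have "\<dots> = (\<Sum>i<k. card (I 0 \<inter> X))"
      by (rule sum.cong[OF refl]) (rule cards, simp)
    also have "\<dots> = k * card (I 0 \<inter> X)" by simp
    finally have "k * card (I 0 \<inter> X) < card (insert e S \<inter> X)" by simp
    also have "\<dots> \<le> card (insert e S \<inter> cl (I 0 \<inter> X))"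
      using X(1)[OF k] by (intro card_mono finite_Int disjI2 finite_subset[OF cl_ground]) auto
    finally show ?thesis using bound[OF X(2)[OF k]] by simp
  qed
qed

lemma empty_in_upow: "{} \<in> upow k"
  by (rule upowI[where P = "\<lambda>_. {}"]) (auto simp: indep_empty)

theorem matroid_covering:
  assumes k: "0 < k" and S: "S \<subseteq> {..<n}"
    and bound: "\<And>J. J \<in> M \<Longrightarrow> card (S \<inter> cl J) \<le> k * card J"
  shows "S \<in> upow k"
proof -
  have "finite S" using S finite_subset by blast
  then show ?thesis using S bound
  proof (induction S rule: finite_induct)
    case empty
    show ?case by (rule empty_in_upow)
  next
    case (insert e S)
    have "card (S \<inter> cl J) \<le> k * card J" if "J \<in> M" for J
    proof -
      have "card (S \<inter> cl J) \<le> card (insert e S \<inter> cl J)"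
        using insert.hyps(1) by (intro card_mono) auto
      then show ?thesis using insert.prems(2)[OF that] by linarith
    qed
    then have "S \<in> upow k" using insert by auto
    then show ?case using upow_insert[OF k] insert by auto
  qed
qed

lemma upow_subset:
  assumes "T \<in> upow k" "S \<subseteq> T"
  shows "S \<in> upow k"
proof -
  obtain P where P: "\<And>l. l < k \<Longrightarrow> P l \<in> M" "T = (\<Union>l<k. P l)"
    "\<And>l l'. l < k \<Longrightarrow> l' < k \<Longrightarrow> l \<noteq> l' \<Longrightarrow> P l \<inter> P l' = {}"
    using upowE[OF assms(1)] by blast
  show ?thesis
    by (rule upowI[where P = "\<lambda>l. P l \<inter> S"]) (use P assms(2) indep_subset in blast)+
qed

lemma upow_ground: "S \<in> upow k \<Longrightarrow> S \<subseteq> {..<n}"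
  by (erule upowE) (use indep_ground in blast)

lemma finite_upow: "finite (upow k)"
  by (rule finite_subset[of _ "Pow {..<n}"]) (use upow_ground in auto)

text \<open>The easy converse of the covering theorem: each of the \<open>k\<close> parts meets
  \<open>cl J\<close> in an independent set, of size at most \<open>card J\<close>.\<close>

lemma upow_card_cl:
  assumes "S \<in> upow k" "J \<in> M"
  shows "card (S \<inter> cl J) \<le> k * card J"
proof -
  obtain P where P: "\<And>l. l < k \<Longrightarrow> P l \<in> M" "S = (\<Union>l<k. P l)"
    using upowE[OF assms(1)] by blast
  have "card (S \<inter> cl J) = card (\<Union>l<k. P l \<inter> cl J)" using P(2) by simp
  also have "\<dots> \<le> (\<Sum>l<k. card (P l \<inter> cl J))" by (rule card_UN_le) simp
  also have "\<dots> \<le> (\<Sum>l<k. card J)"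
    by (rule sum_mono) (use P(1) assms(2) indep_subset indep_card_le_cl in \<open>meson inf_le1 inf_le2 lessThan_iff\<close>)
  finally show ?thesis by simp
qed

lemma upow_disjoint_loops:
  assumes "S \<in> upow k"
  shows "S \<inter> cl {} = {}"
  using upow_card_cl[OF assms indep_empty] finite_subset[OF upow_ground[OF assms]] by auto

end

section \<open>Exponential sums\<close>

lemma sum_power_card_Pow:
  fixes x :: "'a :: comm_semiring_1"
  assumes "finite A"
  shows "(\<Sum>C\<in>Pow A. x ^ card C) = (1 + x) ^ card A"
proof -
  have "(1 + x) ^ card A = (\<Prod>a\<in>A. x + 1)" by (simp add: add.commute)
  also have "\<dots> = (\<Sum>C\<in>Pow A. (\<Prod>a\<in>C. x) * (\<Prod>a\<in>A-C. 1))" by (rule prod_add[OF assms])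
  finally show ?thesis by simp
qed

lemma one_plus_power_le_exp:
  fixes u :: real
  assumes "0 \<le> u"
  shows "(1 + u) ^ m \<le> exp (real m * u)"
proof -
  have "(1 + u) ^ m \<le> exp u ^ m"
    using assms by (intro power_mono exp_ge_add_one_self) auto
  then show ?thesis by (simp add: exp_of_nat_mult)
qed

text \<open>This evaluates a union bound in which a set \<open>J\<close> fails with probability at
  most \<open>x ^ card J\<close>. By the binomial theorem the sum is \<open>(1 + x) ^ n - 1\<close>,
  and the quadratic term of the exponential is absorbed since \<open>n * x\<close> is at most
  1.\<close>

lemma sum_power_card_nonempty_le:
  fixes x :: real
  assumes "0 \<le> x" "real n * x \<le> 1"
  shows "(\<Sum>J\<in>Pow {..<n} - {{}}. x ^ card J) \<le> 2 * real n * x"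
proof -
  have "(\<Sum>J\<in>Pow {..<n} - {{}}. x ^ card J) = (1 + x) ^ n - 1"
    using sum_power_card_Pow[of "{..<n}" x] sum.remove[of "Pow {..<n}" "{}" "\<lambda>J. x ^ card J"] by simp
  also have "\<dots> \<le> exp (real n * x) - 1" using one_plus_power_le_exp[OF assms(1)] by simp
  also have "\<dots> \<le> real n * x + (real n * x)\<^sup>2"
    using exp_bound[of "real n * x"] assms by simp
  also have "(real n * x)\<^sup>2 \<le> real n * x"
    using assms by (simp add: power2_eq_square mult_left_le)
  finally show ?thesis by (simp add: mult_ac)
qed

section \<open>Random arrival orders\<close>

text \<open>Splitting by the last element is what lets an order be revealed backwards.\<close>

lemma sum_permutations_snoc:
  fixes f :: "'a list \<Rightarrow> 'b :: comm_monoid_add"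
  assumes "finite X" "X \<noteq> {}"
  shows "sum f (permutations_of_set X) =
    (\<Sum>x\<in>X. \<Sum>ys\<in>permutations_of_set (X - {x}). f (ys @ [x]))"
proof -
  have eq: "permutations_of_set X = (\<Union>x\<in>X. (\<lambda>ys. ys @ [x]) ` permutations_of_set (X - {x}))"
  proof (intro equalityI subsetI)
    fix xs assume xs: "xs \<in> permutations_of_set X"
    then have "xs \<noteq> []" using assms(2) by (auto simp: permutations_of_set_def)
    then obtain ys x where "xs = ys @ [x]" by (metis append_butlast_last_id)
    moreover from this have "x \<in> X" "ys \<in> permutations_of_set (X - {x})"
      using xs by (auto simp: permutations_of_set_def)
    ultimately show "xs \<in> (\<Union>x\<in>X. (\<lambda>ys. ys @ [x]) ` permutations_of_set (X - {x}))"
      by blast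
  next
    fix xs assume "xs \<in> (\<Union>x\<in>X. (\<lambda>ys. ys @ [x]) ` permutations_of_set (X - {x}))"
    then obtain x ys where "x \<in> X" "ys \<in> permutations_of_set (X - {x})" "xs = ys @ [x]"
      by blast
    then show "xs \<in> permutations_of_set X"
      by (auto simp: permutations_of_set_def)
  qed
  have "sum f (permutations_of_set X) = (\<Sum>x\<in>X. sum f ((\<lambda>ys. ys @ [x]) ` permutations_of_set (X - {x})))"
    unfolding eq using assms(1) by (intro sum.UNION_disjoint) auto
  also have "\<dots> = (\<Sum>x\<in>X. \<Sum>ys\<in>permutations_of_set (X - {x}). f (ys @ [x]))"
    by (rule sum.cong) (auto simp: sum.reindex inj_on_def)
  finally show ?thesis .
qed

text \<open>The run of the rule \<open>B\<close> without any feasibility check; \<open>X\<close>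
  collects the elements that arrived earlier.\<close>

fun tentative :: "('a set \<Rightarrow> 'a set) \<Rightarrow> 'a set \<Rightarrow> 'a list \<Rightarrow> 'a set" where
  "tentative B X [] = {}"
| "tentative B X (x # xs) =
     (if x \<in> B (insert x X) then {x} else {}) \<union> tentative B (insert x X) xs"

lemma tentative_snoc:
  "tentative B X (xs @ [x]) =
     tentative B X xs \<union> (if x \<in> B (insert x (X \<union> set xs)) then {x} else {})"
  by (induction xs arbitrary: X) auto

lemma tentative_subset: "tentative B X xs \<subseteq> set xs"
  by (induction xs arbitrary: X) (auto split: if_splits)

lemma tentative_permutation_snoc:
  assumes "x \<in> X" "ys \<in> permutations_of_set (X - {x})"
  shows "tentative B {} (ys @ [x]) = tentative B {} ys \<union> (if x \<in> B X then {x} else {})"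
proof -
  have "insert x (set ys) = X" using assms by (auto simp: permutations_of_set_def)
  then show ?thesis by (simp add: tentative_snoc)
qed

lemma tentativeD:
  "x \<in> tentative B X xs \<Longrightarrow> \<exists>Y. x \<in> B Y"
  by (induction xs arbitrary: X) (auto split: if_splits)

lemma finite_tentative [simp]: "finite (tentative B X xs)"
  by (rule finite_subset[OF tentative_subset]) simp

text \<open>Revealing the order backwards, the element in position \<open>t\<close> is uniform on the \<open>t\<close> remaining
  ones, so it is a hit with probability at most \<open>a\<close> whatever happens later.\<close>
lemma tentative_mgf:
  fixes a z :: real
  assumes z: "1 \<le> z" and a: "0 \<le> a" and X: "finite X"
    and B: "\<And>Y. Y \<subseteq> X \<Longrightarrow> real (card (Y \<inter> B Y \<inter> F)) \<le> a * real (card Y)"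
  shows "(\<Sum>xs\<in>permutations_of_set X. z ^ card (tentative B {} xs \<inter> F))
    \<le> fact (card X) * (1 + (z - 1) * a) ^ card X"
  using X B
proof (induction X rule: finite_psubset_induct)
  case (psubset X)
  show ?case
  proof (cases "X = {}")
    case False
    obtain m where m: "card X = Suc m" using psubset.hyps False by (metis card_gt_0_iff gr0_implies_Suc)
    define G where "G = (1 + (z - 1) * a) ^ m"
    have G: "0 \<le> G" unfolding G_def using z a by (intro zero_le_power add_nonneg_nonneg mult_nonneg_nonneg) auto
    \<comment> \<open>Given the last arrival \<open>x\<close>, the hit at that position is
      determined by \<open>X\<close> alone, and the earlier arrivals form an arbitrary order of
      \<open>X - {x}\<close>.\<close>
    have step: "(\<Sum>ys\<in>permutations_of_set (X - {x}). z ^ card (tentative B {} (ys @ [x]) \<inter> F))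
      \<le> (if x \<in> B X \<inter> F then z else 1) * (fact m * G)" if x: "x \<in> X" for x
    proof -
      have "(\<Sum>ys\<in>permutations_of_set (X - {x}). z ^ card (tentative B {} (ys @ [x]) \<inter> F))
        = (\<Sum>ys\<in>permutations_of_set (X - {x}).
            (if x \<in> B X \<inter> F then z else 1) * z ^ card (tentative B {} ys \<inter> F))"
      proof (rule sum.cong[OF refl])
        fix ys assume ys: "ys \<in> permutations_of_set (X - {x})"
        then have "x \<notin> tentative B {} ys"
          using tentative_subset[of B "{}" ys] by (auto simp: permutations_of_set_def)
        then show "z ^ card (tentative B {} (ys @ [x]) \<inter> F) =
            (if x \<in> B X \<inter> F then z else 1) * z ^ card (tentative B {} ys \<inter> F)"
          using tentative_permutation_snoc[OF x ys, of B] by (auto simp: Int_insert_left)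
      qed
      also have "\<dots> = (if x \<in> B X \<inter> F then z else 1) *
          (\<Sum>ys\<in>permutations_of_set (X - {x}). z ^ card (tentative B {} ys \<inter> F))"
        by (simp add: sum_distrib_left)
      also have "\<dots> \<le> (if x \<in> B X \<inter> F then z else 1) * (fact m * G)"
      proof (rule mult_left_mono)
        have "card (X - {x}) = m" using m x psubset.hyps by simp
        then show "(\<Sum>ys\<in>permutations_of_set (X - {x}). z ^ card (tentative B {} ys \<inter> F)) \<le> fact m * G"
          using psubset.IH[of "X - {x}"] psubset.prems x unfolding G_def by (simp add: psubset_eq subset_Diff_insert) blast
      qed (use z in auto)
      finally show ?thesis .
    qed
    have "(\<Sum>xs\<in>permutations_of_set X. z ^ card (tentative B {} xs \<inter> F))
      \<le> (\<Sum>x\<in>X. (if x \<in> B X \<inter> F then z else 1) * (fact m * G))"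
      unfolding sum_permutations_snoc[OF psubset.hyps False] by (rule sum_mono[OF step])
    also have "\<dots> = (\<Sum>x\<in>X. (if x \<in> B X \<inter> F then z else 1)) * (fact m * G)"
      by (simp only: sum_distrib_right)
    also have "(\<Sum>x\<in>X. (if x \<in> B X \<inter> F then z else 1)) = (\<Sum>x\<in>X. 1 + (z - 1) * (if x \<in> B X \<inter> F then 1 else 0))"
      by (rule sum.cong) auto
    also have "\<dots> = real (card X) + (z - 1) * real (card (X \<inter> B X \<inter> F))"
      using psubset.hyps by (simp add: sum.distrib sum_distrib_left[symmetric] sum.If_cases Int_def conj_assoc)
    also have "\<dots> * (fact m * G) \<le> (real (card X) + (z - 1) * (a * real (card X))) * (fact m * G)"
      using psubset.prems[of X] z G by (intro mult_right_mono add_left_mono mult_left_mono) auto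
    also have "\<dots> = fact (card X) * (1 + (z - 1) * a) ^ card X"
      unfolding m G_def by (simp add: algebra_simps)
    finally show ?thesis .
  qed simp
qed

text \<open>Markov's inequality for \<open>exp l\<close> to the number of hits, in counting form:
  \<open>fact (card X)\<close> is the number of orders.\<close>

lemma tentative_tail:
  fixes a l :: real
  assumes l: "0 \<le> l" and a: "0 \<le> a" and X: "finite X"
    and B: "\<And>Y. Y \<subseteq> X \<Longrightarrow> real (card (Y \<inter> B Y \<inter> F)) \<le> a * real (card Y)"
  shows "real (card {xs \<in> permutations_of_set X. m < card (tentative B {} xs \<inter> F)})
    \<le> fact (card X) * exp ((exp l - 1) * a * real (card X) - l * real m)"
proof -
  let ?P = "permutations_of_set X"
  let ?Q = "{xs \<in> ?P. m < card (tentative B {} xs \<inter> F)}"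
  have "real (card ?Q) * exp l ^ m = (\<Sum>xs\<in>?Q. exp l ^ m)" by simp
  also have "\<dots> \<le> (\<Sum>xs\<in>?Q. exp l ^ card (tentative B {} xs \<inter> F))"
    using l by (intro sum_mono power_increasing) auto
  also have "\<dots> \<le> (\<Sum>xs\<in>?P. exp l ^ card (tentative B {} xs \<inter> F))"
    by (rule sum_mono2) auto
  also have "\<dots> \<le> fact (card X) * (1 + (exp l - 1) * a) ^ card X"
    by (rule tentative_mgf) (use l a X B in auto)
  also have "\<dots> \<le> fact (card X) * exp (real (card X) * ((exp l - 1) * a))"
    using l a by (intro mult_left_mono one_plus_power_le_exp) auto
  finally have "real (card ?Q) \<le> fact (card X) * exp (real (card X) * ((exp l - 1) * a)) / exp l ^ m"
    by (simp add: pos_le_divide_eq)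
  also have "\<dots> = fact (card X) * exp ((exp l - 1) * a * real (card X) - l * real m)"
    by (simp add: exp_diff exp_of_nat_mult[symmetric] mult_ac)
  finally show ?thesis .
qed

section \<open>Random subsets of fixed size\<close>

abbreviation subsets_card :: "nat \<Rightarrow> nat \<Rightarrow> nat set set" where
  "subsets_card n t \<equiv> {S. S \<subseteq> {..<n} \<and> card S = t}"

lemma finite_subsets_card [simp]: "finite (subsets_card n t)"
  by (rule finite_subset[of _ "Pow {..<n}"]) auto

lemma card_subsets_containing:
  assumes C: "C \<subseteq> {..<n}" "card C \<le> t"
  shows "card {S \<in> subsets_card n t. C \<subseteq> S} = (n - card C) choose (t - card C)"
proof -
  have fC: "finite C" using C finite_subset by blast
  have "bij_betw (\<lambda>S. S - C) {S \<in> subsets_card n t. C \<subseteq> S}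
      {T. T \<subseteq> {..<n} - C \<and> card T = t - card C}"
  proof (rule bij_betw_byWitness[where f' = "\<lambda>T. T \<union> C"])
    show "(\<lambda>T. T \<union> C) ` {T. T \<subseteq> {..<n} - C \<and> card T = t - card C} \<subseteq> {S \<in> subsets_card n t. C \<subseteq> S}"
    proof clarsimp
      fix T assume T: "T \<subseteq> {..<n} - C" "card T = t - card C"
      then have "finite T" "T \<inter> C = {}" using finite_subset by blast+
      then show "T \<subseteq> {..<n} \<and> C \<subseteq> {..<n} \<and> card (T \<union> C) = t"
        using T C fC by (auto simp: card_Un_disjoint)
    qed
    show "(\<lambda>S. S - C) ` {S \<in> subsets_card n t. C \<subseteq> S} \<subseteq> {T. T \<subseteq> {..<n} - C \<and> card T = t - card C}"
      using fC by (auto simp: card_Diff_subset)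
  qed auto
  then show ?thesis
    using n_subsets[of "{..<n} - C" "t - card C"] C fC by (simp add: bij_betw_same_card card_Diff_subset)
qed

text \<open>A random \<open>t\<close>-subset contains a fixed \<open>c\<close>-set with probability
  at most \<open>(t / n) ^ c\<close>, because each further element costs a factor
  \<open>(t - c) / (n - c) \<le> t / n\<close>.\<close>

lemma choose_diff_le:
  assumes "c \<le> t" "t \<le> n"
  shows "((n - c) choose (t - c)) * n ^ c \<le> t ^ c * (n choose t)"
  using assms(1)
proof (induction c)
  case (Suc c)
  let ?u = "(n - Suc c) choose (t - Suc c)" and ?v = "(n - c) choose (t - c)"
  have e: "n - c = Suc (n - Suc c)" "t - c = Suc (t - Suc c)" using Suc.prems assms(2) by auto
  have "(n - c) * ?u = (t - c) * ?v"
    using Suc_times_binomial[of "t - Suc c" "n - Suc c"] e by metis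
  moreover have "n * (t - c) \<le> t * (n - c)"
    using assms(2) by (simp add: diff_mult_distrib2 mult.commute diff_le_mono2)
  ultimately have "n * ((n - c) * ?u) \<le> t * (n - c) * ?v"
    by (simp only: mult.assoc[symmetric] mult_le_mono1)
  then have "(n - c) * (n * ?u) \<le> (n - c) * (t * ?v)"
    by (simp only: mult_ac)
  then have "n * ?u \<le> t * ?v" using e by (metis mult_le_cancel1 zero_less_Suc)
  then have "(n * ?u) * n ^ c \<le> (t * ?v) * n ^ c" by (rule mult_le_mono1)
  then have "?u * n ^ Suc c \<le> t * (?v * n ^ c)" by (simp only: power_Suc mult_ac)
  also have "\<dots> \<le> t * (t ^ c * (n choose t))" using Suc by simp
  finally show ?case by simp
qed simp

lemma card_subsets_containing_le:
  assumes C: "C \<subseteq> {..<n}" and t: "t \<le> n" and n: "0 < n"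
  shows "real (card {S \<in> subsets_card n t. C \<subseteq> S}) \<le> real (n choose t) * (real t / real n) ^ card C"
proof (cases "card C \<le> t")
  case True
  have "real (((n - card C) choose (t - card C)) * n ^ card C) \<le> real (t ^ card C * (n choose t))"
    using choose_diff_le[OF True t] by (rule of_nat_mono)
  then show ?thesis
    unfolding card_subsets_containing[OF C True] using n by (simp add: power_divide field_simps)
next
  case False
  have "{S \<in> subsets_card n t. C \<subseteq> S} = {}"
    using False by (auto dest: card_mono[rotated] simp: finite_subset[OF _ finite_lessThan])
  then show ?thesis by (simp only: card.empty) simp
qed

text \<open>Expand \<open>z ^ card (S \<inter> D)\<close> over the subsets \<open>C\<close> of
  \<open>S \<inter> D\<close> with coefficients \<open>(z - 1) ^ card C\<close>. These are
  nonnegative, so sampling without replacement is bounded by independent sampling with probability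
  \<open>t / n\<close>.\<close>

lemma subsets_card_mgf:
  fixes z :: real
  assumes z: "1 \<le> z" and D: "D \<subseteq> {..<n}" and t: "t \<le> n" and n: "0 < n"
  shows "(\<Sum>S\<in>subsets_card n t. z ^ card (S \<inter> D))
    \<le> real (n choose t) * (1 + (z - 1) * (real t / real n)) ^ card D"
proof -
  have fD: "finite D" using D finite_subset by blast
  have "(\<Sum>S\<in>subsets_card n t. z ^ card (S \<inter> D))
    = (\<Sum>S\<in>subsets_card n t. \<Sum>C\<in>{C \<in> Pow D. C \<subseteq> S}. (z - 1) ^ card C)"
  proof (rule sum.cong[OF refl])
    fix S
    have "{C \<in> Pow D. C \<subseteq> S} = Pow (S \<inter> D)" by auto
    then show "z ^ card (S \<inter> D) = (\<Sum>C\<in>{C \<in> Pow D. C \<subseteq> S}. (z - 1) ^ card C)"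
      using sum_power_card_Pow[of "S \<inter> D" "z - 1"] fD by simp
  qed
  also have "\<dots> = (\<Sum>C\<in>Pow D. \<Sum>S\<in>{S \<in> subsets_card n t. C \<subseteq> S}. (z - 1) ^ card C)"
    by (rule sum.swap_restrict) (use fD in auto)
  also have "\<dots> = (\<Sum>C\<in>Pow D. real (card {S \<in> subsets_card n t. C \<subseteq> S}) * (z - 1) ^ card C)"
    by simp
  also have "\<dots> \<le> (\<Sum>C\<in>Pow D. (real (n choose t) * (real t / real n) ^ card C) * (z - 1) ^ card C)"
    using D z by (intro sum_mono mult_right_mono card_subsets_containing_le t n) auto
  also have "\<dots> = real (n choose t) * (\<Sum>C\<in>Pow D. ((z - 1) * (real t / real n)) ^ card C)"
    by (simp add: sum_distrib_left power_mult_distrib mult_ac del: times_divide_eq_right times_divide_eq_left)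
  also have "\<dots> = real (n choose t) * (1 + (z - 1) * (real t / real n)) ^ card D"
    by (simp add: sum_power_card_Pow[OF fD])
  finally show ?thesis .
qed

lemma subsets_card_tail:
  fixes l :: real
  assumes l: "0 \<le> l" and D: "D \<subseteq> {..<n}" and t: "t \<le> n" and n: "0 < n"
  shows "real (card {S \<in> subsets_card n t. m < card (S \<inter> D)})
    \<le> real (n choose t) * exp ((exp l - 1) * (real t / real n) * real (card D) - l * real m)"
proof -
  let ?Q = "{S \<in> subsets_card n t. m < card (S \<inter> D)}"
  have "real (card ?Q) * exp l ^ m = (\<Sum>S\<in>?Q. exp l ^ m)" by simp
  also have "\<dots> \<le> (\<Sum>S\<in>?Q. exp l ^ card (S \<inter> D))"
    using l by (intro sum_mono power_increasing) auto
  also have "\<dots> \<le> (\<Sum>S\<in>subsets_card n t. exp l ^ card (S \<inter> D))"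
    by (rule sum_mono2) auto
  also have "\<dots> \<le> real (n choose t) * (1 + (exp l - 1) * (real t / real n)) ^ card D"
    by (rule subsets_card_mgf) (use l D t n in auto)
  also have "\<dots> \<le> real (n choose t) * exp (real (card D) * ((exp l - 1) * (real t / real n)))"
    using l by (intro mult_left_mono one_plus_power_le_exp) auto
  finally have "real (card ?Q)
      \<le> real (n choose t) * exp (real (card D) * ((exp l - 1) * (real t / real n))) / exp l ^ m"
    by (simp add: pos_le_divide_eq)
  also have "\<dots> = real (n choose t) * exp ((exp l - 1) * (real t / real n) * real (card D) - l * real m)"
    by (simp add: exp_diff exp_of_nat_mult[symmetric] mult_ac)
  finally show ?thesis .
qed

lemma subsets_card_sum_weights:
  fixes w :: "nat \<Rightarrow> real"
  assumes D: "D \<subseteq> {..<n}" and t: "0 < t" "t \<le> n"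
  shows "(\<Sum>S\<in>subsets_card n t. sum w (S \<inter> D)) = real (n choose t) * (real t / real n) * sum w D"
proof -
  have fD: "finite D" using D finite_subset by blast
  obtain t' n' where tn: "t = Suc t'" "n = Suc n'"
    using t by (metis Suc_le_D gr0_implies_Suc)
  have "(\<Sum>S\<in>subsets_card n t. sum w (S \<inter> D)) = (\<Sum>S\<in>subsets_card n t. \<Sum>i\<in>{i \<in> D. i \<in> S}. w i)"
    by (intro sum.cong) auto
  also have "\<dots> = (\<Sum>i\<in>D. \<Sum>S\<in>{S \<in> subsets_card n t. i \<in> S}. w i)"
    by (rule sum.swap_restrict) (use fD in auto)
  also have "\<dots> = (\<Sum>i\<in>D. real (n choose t) * (real t / real n) * w i)"
  proof (rule sum.cong[OF refl])
    fix i assume "i \<in> D"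
    then have "card {S \<in> subsets_card n t. i \<in> S} = (n - 1) choose (t - 1)"
      using card_subsets_containing[of "{i}" n t] D t by auto
    moreover have "real n * real ((n - 1) choose (t - 1)) = real t * real (n choose t)"
      using Suc_times_binomial[of t' n'] tn by (metis diff_Suc_1 of_nat_mult)
    then have "real ((n - 1) choose (t - 1)) = real (n choose t) * (real t / real n)"
      using tn by (simp add: field_simps)
    ultimately show "(\<Sum>S\<in>{S \<in> subsets_card n t. i \<in> S}. w i) = real (n choose t) * (real t / real n) * w i"
      by simp
  qed
  finally show ?thesis by (simp add: sum_distrib_left)
qed

text \<open>Double counting: a \<open>t\<close>-set \<open>R\<close> arises as
  \<open>S - {x}\<close> once for each of the \<open>n - t\<close> elements \<open>x\<close> outside
  \<open>R\<close>.\<close>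

lemma sum_subsets_card_remove:
  fixes f :: "nat set \<Rightarrow> real"
  shows "(\<Sum>S\<in>subsets_card n (Suc t). \<Sum>x\<in>S. f (S - {x})) = real (n - t) * (\<Sum>R\<in>subsets_card n t. f R)"
proof -
  have fin: "finite S" if "S \<in> subsets_card n m" for S m
    using that finite_subset by blast
  have "(\<Sum>S\<in>subsets_card n (Suc t). \<Sum>x\<in>S. f (S - {x}))
    = (\<Sum>(S, x)\<in>Sigma (subsets_card n (Suc t)) (\<lambda>S. S). f (S - {x}))"
    by (rule sum.Sigma) (use fin in auto)
  also have "\<dots> = (\<Sum>(R, x)\<in>Sigma (subsets_card n t) (\<lambda>R. {..<n} - R). f R)"
    by (rule sum.reindex_bij_witness[where i = "\<lambda>(R, x). (insert x R, x)" and j = "\<lambda>(S, x). (S - {x}, x)"])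
      (auto simp: finite_subset[OF _ finite_lessThan])
  also have "\<dots> = (\<Sum>R\<in>subsets_card n t. \<Sum>x\<in>{..<n} - R. f R)"
    by (rule sum.Sigma[symmetric]) auto
  also have "\<dots> = (\<Sum>R\<in>subsets_card n t. real (n - t) * f R)"
  proof (rule sum.cong[OF refl])
    fix R assume R: "R \<in> subsets_card n t"
    then have "card ({..<n} - R) = n - t" using fin[OF R] by (simp add: card_Diff_subset)
    then show "(\<Sum>x\<in>{..<n} - R. f R) = real (n - t) * f R" by simp
  qed
  finally show ?thesis by (simp add: sum_distrib_left)
qed

section \<open>Expected weight of a tentative run\<close>

definition mean_tentative :: "(nat \<Rightarrow> real) \<Rightarrow> (nat set \<Rightarrow> nat set) \<Rightarrow> nat set \<Rightarrow> real" where
  "mean_tentative w B X =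
     (\<Sum>xs\<in>permutations_of_set X. sum w (tentative B {} xs)) / fact (card X)"

text \<open>The last arrival is uniform on \<open>X\<close> and is selected iff it lies in
  \<open>B X\<close>; the others arrive in uniform order.\<close>

lemma mean_tentative_rec:
  assumes X: "finite X" "X \<noteq> {}" and B: "B X \<subseteq> X"
  shows "mean_tentative w B X = (sum w (B X) + (\<Sum>x\<in>X. mean_tentative w B (X - {x}))) / real (card X)"
proof -
  obtain m where m: "card X = Suc m" using X by (metis card_gt_0_iff gr0_implies_Suc)
  have step: "(\<Sum>ys\<in>permutations_of_set (X - {x}). sum w (tentative B {} (ys @ [x])))
    = fact m * (mean_tentative w B (X - {x}) + (if x \<in> B X then w x else 0))" if x: "x \<in> X" for x
  proof -
    have cm: "card (X - {x}) = m" using m x X by simp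
    have "(\<Sum>ys\<in>permutations_of_set (X - {x}). sum w (tentative B {} (ys @ [x])))
      = (\<Sum>ys\<in>permutations_of_set (X - {x}). sum w (tentative B {} ys) + (if x \<in> B X then w x else 0))"
    proof (rule sum.cong[OF refl])
      fix ys assume ys: "ys \<in> permutations_of_set (X - {x})"
      then have "x \<notin> tentative B {} ys"
        using tentative_subset[of B "{}" ys] by (auto simp: permutations_of_set_def)
      then show "sum w (tentative B {} (ys @ [x])) = sum w (tentative B {} ys) + (if x \<in> B X then w x else 0)"
        using tentative_permutation_snoc[OF x ys, of B] by simp
    qed
    then show ?thesis using X cm by (simp add: sum.distrib mean_tentative_def ring_distribs)
  qed
  have "(\<Sum>xs\<in>permutations_of_set X. sum w (tentative B {} xs))
     = (\<Sum>x\<in>X. fact m * (mean_tentative w B (X - {x}) + (if x \<in> B X then w x else 0)))"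
    unfolding sum_permutations_snoc[OF X] by (rule sum.cong[OF refl step])
  also have "\<dots> = fact m * ((\<Sum>x\<in>X. mean_tentative w B (X - {x})) + (\<Sum>x\<in>X. if x \<in> B X then w x else 0))"
    by (simp only: sum_distrib_left[symmetric] sum.distrib)
  also have "(\<Sum>x\<in>X. if x \<in> B X then w x else 0) = sum w (B X)"
    using X B by (simp add: sum.inter_restrict[symmetric] Int_absorb1)
  finally have "(\<Sum>xs\<in>permutations_of_set X. sum w (tentative B {} xs))
      = fact m * (sum w (B X) + (\<Sum>x\<in>X. mean_tentative w B (X - {x})))"
    by (simp only: add.commute)
  then show ?thesis
    unfolding mean_tentative_def[of w B X] m fact_Suc of_nat_mult by simp
qed

text \<open>The first \<open>t\<close> arrivals form a uniform \<open>t\<close>-subset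
  \<open>S\<close>, and the \<open>t\<close>-th of them is uniform on \<open>S\<close>, so step
  \<open>t\<close> collects a \<open>1 / t\<close> fraction of the weight of \<open>B S\<close> on
  average. The proof averages the recursion over all \<open>t\<close>-subsets.\<close>

lemma mean_tentative_eq:
  assumes B: "\<And>X. B X \<subseteq> X"
  shows "mean_tentative w B {..<n} =
    (\<Sum>t=1..n. (\<Sum>S\<in>subsets_card n t. sum w (B S)) / (real t * real (n choose t)))"
proof -
  have "t \<le> n \<Longrightarrow> (\<Sum>S\<in>subsets_card n t. mean_tentative w B S) / real (n choose t)
     = (\<Sum>s=1..t. (\<Sum>S\<in>subsets_card n s. sum w (B S)) / (real s * real (n choose s)))" for t
  proof (induction t)
    case 0
    have "subsets_card n 0 = {{}}" by (auto simp: finite_subset[OF _ finite_lessThan])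
    then show ?case by (simp add: mean_tentative_def)
  next
    case (Suc t)
    have "(\<Sum>S\<in>subsets_card n (Suc t). mean_tentative w B S)
      = (\<Sum>S\<in>subsets_card n (Suc t). (sum w (B S) + (\<Sum>x\<in>S. mean_tentative w B (S - {x}))) / real (Suc t))"
    proof (rule sum.cong[OF refl])
      fix S assume "S \<in> subsets_card n (Suc t)"
      then have "finite S" "S \<noteq> {}" "card S = Suc t" by (auto simp: finite_subset[OF _ finite_lessThan])
      then show "mean_tentative w B S = (sum w (B S) + (\<Sum>x\<in>S. mean_tentative w B (S - {x}))) / real (Suc t)"
        using mean_tentative_rec[of S B w] B[of S] by simp
    qed
    also have "\<dots> = ((\<Sum>S\<in>subsets_card n (Suc t). sum w (B S))
        + real (n - t) * (\<Sum>R\<in>subsets_card n t. mean_tentative w B R)) / real (Suc t)"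
      by (simp only: sum_divide_distrib[symmetric] sum.distrib sum_subsets_card_remove)
    finally have eq: "(\<Sum>S\<in>subsets_card n (Suc t). mean_tentative w B S) / real (n choose Suc t)
       = (\<Sum>S\<in>subsets_card n (Suc t). sum w (B S)) / (real (Suc t) * real (n choose Suc t))
        + real (n - t) * (\<Sum>R\<in>subsets_card n t. mean_tentative w B R) / (real (Suc t) * real (n choose Suc t))"
      by (simp add: add_divide_distrib)
    \<comment> \<open>With this absorption identity the average over \<open>t\<close>-subsets enters
      with coefficient exactly 1, so the recursion telescopes.\<close>
    have "Suc t * (n choose Suc t) = (n - t) * (n choose t)"
      using Suc.prems by (metis binomial_absorb_comp binomial_absorption mult.commute)
    then have "real (Suc t) * real (n choose Suc t) = real (n - t) * real (n choose t)"
      by (metis of_nat_mult)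
    then have "real (n - t) * (\<Sum>R\<in>subsets_card n t. mean_tentative w B R) / (real (Suc t) * real (n choose Suc t))
       = (\<Sum>R\<in>subsets_card n t. mean_tentative w B R) / real (n choose t)"
      using Suc.prems by simp
    then show ?case using eq Suc by simp
  qed
  from this[of n] show ?thesis
  proof -
    have "subsets_card n n = {{..<n}}"
      using card_subset_eq[of "{..<n}"] by auto
    then show ?thesis using \<open>n \<le> n \<Longrightarrow> _\<close> by simp
  qed
qed

section \<open>Executing a tentative selection rule\<close>

lemma run_nonneg:
  assumes "valid_alg A" "\<And>i. i \<in> set xs \<Longrightarrow> 0 \<le> w i"
  shows "0 \<le> run A F w h S xs"
  using assms(2)
proof (induction xs arbitrary: h S)
  case (Cons i xs)
  have A: "0 \<le> A h' T" "A h' T \<le> 1" for h' T using assms(1) by (auto simp: valid_alg_def)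
  show ?case using Cons A
    by (auto simp: Let_def intro!: add_nonneg_nonneg mult_nonneg_nonneg)
qed simp

text \<open>\<open>R w X\<close> is the set a rule would select if exactly \<open>X\<close> had arrived; the current element is
  accepted if it belongs to the selection from everything seen so far.\<close>
definition alg_of :: "((nat \<Rightarrow> real) \<Rightarrow> nat set \<Rightarrow> nat set) \<Rightarrow> online_alg" where
  "alg_of R h S =
     (if fst (last h) \<in> R (\<lambda>i. the (map_of h i)) (fst ` set h) then 1 else 0)"

lemma valid_alg_of: "valid_alg (alg_of R)"
  by (simp add: valid_alg_def alg_of_def)

lemma map_of_graph: "i \<in> set xs \<Longrightarrow> map_of (map (\<lambda>i. (i, w i)) xs) i = Some (w i)"
  by (induction xs) auto

text \<open>The weights read off the history agree with \<open>w\<close> on arrived elements only.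
  The hypothesis \<open>local\<close> says that the rule looks at no others, which makes it
  implementable online.\<close>

lemma alg_of_graph:
  assumes local: "\<And>W X. (\<And>i. i \<in> X \<Longrightarrow> W i = w i) \<Longrightarrow> R W X = R w X"
  shows "alg_of R (map (\<lambda>i. (i, w i)) ys @ [(x, w x)]) S =
    (if x \<in> R w (insert x (set ys)) then 1 else 0)"
proof -
  let ?h = "map (\<lambda>i. (i, w i)) (ys @ [x])"
  have set: "fst ` set ?h = insert x (set ys)" by (auto simp: image_image)
  have "R (\<lambda>i. the (map_of ?h i)) (insert x (set ys)) = R w (insert x (set ys))"
  proof (rule local)
    fix i assume "i \<in> insert x (set ys)"
    then show "the (map_of ?h i) = w i" using map_of_graph[of i "ys @ [x]" w] by simp
  qed
  then have "alg_of R ?h S = (if x \<in> R w (insert x (set ys)) then 1 else 0)"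
    unfolding alg_of_def set by simp
  then show ?thesis by simp
qed

text \<open>If the whole tentative set is feasible, downward closure makes every intermediate set
  feasible, so the feasibility check never rejects.\<close>

lemma run_alg_of:
  assumes local: "\<And>W X. (\<And>i. i \<in> X \<Longrightarrow> W i = w i) \<Longrightarrow> R W X = R w X"
    and down: "\<And>T S. T \<in> F \<Longrightarrow> S \<subseteq> T \<Longrightarrow> S \<in> F"
    and "distinct xs" "S \<inter> set xs = {}" "S \<union> tentative (R w) (set ys) xs \<in> F"
  shows "run (alg_of R) F w (map (\<lambda>i. (i, w i)) ys) S xs = sum w (tentative (R w) (set ys) xs)"
  using assms(3-5)
proof (induction xs arbitrary: ys S)
  case (Cons x xs)
  have A: "alg_of R (map (\<lambda>i. (i, w i)) ys @ [(x, w x)]) S = (if x \<in> R w (insert x (set ys)) then 1 else 0)"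
    using alg_of_graph[of w R, OF local] .
  have IH: "run (alg_of R) F w (map (\<lambda>i. (i, w i)) ys @ [(x, w x)]) S' xs
      = sum w (tentative (R w) (insert x (set ys)) xs)"
    if "S' \<inter> set xs = {}" "S' \<union> tentative (R w) (insert x (set ys)) xs \<in> F" for S'
    using Cons.IH[of S' "ys @ [x]"] that Cons.prems(1) by simp
  show ?case
  proof (cases "x \<in> R w (insert x (set ys))")
    case True
    have "insert x S \<in> F" using down[OF Cons.prems(3), of "insert x S"] True by auto
    moreover have "x \<notin> tentative (R w) (insert x (set ys)) xs"
      using tentative_subset[of "R w" "insert x (set ys)" xs] Cons.prems(1) by auto
    moreover have "run (alg_of R) F w (map (\<lambda>i. (i, w i)) ys @ [(x, w x)]) (insert x S) xs
      = sum w (tentative (R w) (insert x (set ys)) xs)"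
      using True Cons.prems by (intro IH) auto
    ultimately show ?thesis using True A by (simp add: Let_def)
  next
    case False
    have "run (alg_of R) F w (map (\<lambda>i. (i, w i)) ys @ [(x, w x)]) S xs
      = sum w (tentative (R w) (insert x (set ys)) xs)"
      using False Cons.prems by (intro IH) auto
    then show ?thesis using False A by (simp add: Let_def)
  qed
qed simp

text \<open>On an order whose tentative set is infeasible the algorithm still collects at least 0,
  while the tentative weight is at most \<open>K\<close>. The loss is therefore at most
  \<open>K\<close> times the failure probability.\<close>

lemma expected_alg_ge:
  assumes local: "\<And>W X. (\<And>i. i \<in> X \<Longrightarrow> W i = w i) \<Longrightarrow> R W X = R w X"
    and down: "\<And>T S. T \<in> F \<Longrightarrow> S \<subseteq> T \<Longrightarrow> S \<in> F"
    and w: "\<And>i. i < n \<Longrightarrow> 0 \<le> w i"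
    and K: "\<And>xs. xs \<in> permutations_of_set {..<n} \<Longrightarrow> sum w (tentative (R w) {} xs) \<le> K"
  shows "expected_alg n (alg_of R) F w \<ge> mean_tentative w (R w) {..<n}
    - K * (real (card {xs \<in> permutations_of_set {..<n}. tentative (R w) {} xs \<notin> F}) / fact n)"
proof -
  let ?P = "permutations_of_set {..<n}"
  have "sum w (tentative (R w) {} xs) - (if tentative (R w) {} xs \<notin> F then K else 0)
      \<le> run (alg_of R) F w [] {} xs" if xs: "xs \<in> ?P" for xs
  proof (cases "tentative (R w) {} xs \<in> F")
    case True
    have "run (alg_of R) F w (map (\<lambda>i. (i, w i)) []) {} xs = sum w (tentative (R w) (set []) xs)"
    proof (rule run_alg_of)
      show "R W X = R w X" if "\<And>i. i \<in> X \<Longrightarrow> W i = w i" for W X using that by (rule local)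
      show "S \<in> F" if "T \<in> F" "S \<subseteq> T" for T S using that by (rule down)
    qed (use True xs in \<open>simp_all add: permutations_of_set_def\<close>)
    then show ?thesis using True by simp
  next
    case False
    have "0 \<le> run (alg_of R) F w [] {} xs"
      using xs w by (intro run_nonneg valid_alg_of) (auto simp: permutations_of_set_def)
    then show ?thesis using False K[OF xs] by simp
  qed
  then have "(\<Sum>xs\<in>?P. sum w (tentative (R w) {} xs) - (if tentative (R w) {} xs \<notin> F then K else 0))
      \<le> (\<Sum>xs\<in>?P. run (alg_of R) F w [] {} xs)" by (rule sum_mono)
  moreover have "(\<Sum>xs\<in>?P. if tentative (R w) {} xs \<notin> F then K else 0)
      = K * real (card {xs \<in> ?P. tentative (R w) {} xs \<notin> F})"
    by (simp add: sum.inter_filter[symmetric])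
  ultimately have "(\<Sum>xs\<in>?P. sum w (tentative (R w) {} xs)) - K * real (card {xs \<in> ?P. tentative (R w) {} xs \<notin> F})
      \<le> (\<Sum>xs\<in>?P. run (alg_of R) F w [] {} xs)"
    by (simp only: sum_subtractf)
  then have "((\<Sum>xs\<in>?P. sum w (tentative (R w) {} xs)) - K * real (card {xs \<in> ?P. tentative (R w) {} xs \<notin> F})) / fact n
      \<le> (\<Sum>xs\<in>?P. run (alg_of R) F w [] {} xs) / fact n"
    by (rule divide_right_mono) simp
  moreover have "?P = {xs. distinct xs \<and> set xs = {..<n}}" by (auto simp: permutations_of_set_def)
  ultimately show ?thesis
    unfolding expected_alg_def mean_tentative_def by (simp add: diff_divide_distrib)
qed

section \<open>The selection rule\<close>

text \<open>Replacing \<open>exp x\<close> by \<open>1 + x + x\<^sup>2\<close> at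
  \<open>x = e / 2\<close> leaves exactly \<open>- e\<^sup>2 y / 4 - e\<^sup>3 y / 4\<close>. In
  use, \<open>y\<close> is the capacity \<open>k * card J\<close>.\<close>

lemma chernoff_exponent_le:
  fixes e :: real
  assumes "0 \<le> e" "e \<le> 1" "0 \<le> y"
  shows "(exp (e / 2) - 1) * ((1 - e) * y) - e / 2 * y \<le> - (e\<^sup>2 * y / 4)"
proof -
  have "exp (e / 2) - 1 \<le> e / 2 + (e / 2)\<^sup>2" using exp_bound[of "e / 2"] assms by simp
  then have "(exp (e / 2) - 1) * ((1 - e) * y) \<le> (e / 2 + (e / 2)\<^sup>2) * ((1 - e) * y)"
    using assms by (intro mult_right_mono) auto
  moreover have "(e / 2 + (e / 2)\<^sup>2) * ((1 - e) * y) - e / 2 * y + e\<^sup>2 * y / 4 = - (e ^ 3 * y / 4)"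
    by (simp add: field_simps power2_eq_square power3_eq_cube)
  moreover have "0 \<le> e ^ 3 * y / 4" using assms by simp
  ultimately show ?thesis by linarith
qed

text \<open>Here \<open>K\<close> stands for \<open>k t / n\<close>, \<open>m\<close> for the
  rounded capacity and \<open>u\<close> for a mean load. The slack \<open>e \<le> h\<close> and the
  rounding, worth at most \<open>h K\<close>, give \<open>m \<ge> (1 - 2 h) K\<close>; so a gap
  \<open>h K\<close> above the load remains. It yields the exponent
  \<open>- h\<^sup>2 K / 4\<close>, which is \<open>- 4 L\<close> by the choice of the constant in
  \<open>h\<close>.\<close>

lemma sampling_exponent_le:
  fixes L K h e m u :: real
  assumes L: "1 / 2 \<le> L" and K: "0 < K" and h: "h = 4 * sqrt (L / K)" "4 * h \<le> 1"
    and e: "e \<le> h" and m: "(1 - e) * K - 1 \<le> m" and u: "u \<le> K * (1 - 3 * h)"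
  shows "(exp (h / 2) - 1) * u - h / 2 * m \<le> - 4 * L" and "0 < m" and "1 \<le> h * K"
proof -
  have h0: "0 < h" using h L K by simp
  have hK: "h\<^sup>2 * K = 16 * L" using h L K by (simp add: power_mult_distrib)
  have "1 \<le> 16 * L" using L by simp
  also have "\<dots> = h * (h * K)" using hK by (simp add: power2_eq_square)
  also have "\<dots> \<le> 1 * (h * K)" using h h0 K by (intro mult_right_mono) auto
  finally show hK1: "1 \<le> h * K" by simp
  have "e * K \<le> h * K" using e K by simp
  then have m': "(1 - 2 * h) * K \<le> m" using m hK1 by (simp add: algebra_simps)
  have "0 < (1 - 2 * h) * K" using h K by simp
  then show "0 < m" using m' by linarith
  have "exp (h / 2) - 1 \<le> h / 2 + (h / 2)\<^sup>2" using exp_bound[of "h / 2"] h h0 by simp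
  moreover have "0 \<le> K * (1 - 3 * h)" using K h by simp
  ultimately have "(exp (h / 2) - 1) * (K * (1 - 3 * h)) \<le> (h / 2 + (h / 2)\<^sup>2) * (K * (1 - 3 * h))"
    by (intro mult_right_mono) auto
  moreover have "(exp (h / 2) - 1) * u \<le> (exp (h / 2) - 1) * (K * (1 - 3 * h))"
    using u h0 by (intro mult_left_mono) auto
  moreover have "h / 2 * ((1 - 2 * h) * K) \<le> h / 2 * m"
    using m' h0 by (intro mult_left_mono) auto
  moreover have "(h / 2 + (h / 2)\<^sup>2) * (K * (1 - 3 * h)) - h / 2 * ((1 - 2 * h) * K)
      = - (h\<^sup>2 * K / 4) - 3 * (h ^ 3 * K) / 4"
    by (simp add: field_simps power2_eq_square power3_eq_cube)
  moreover have "0 \<le> h ^ 3 * K" using h0 K by simp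
  ultimately show "(exp (h / 2) - 1) * u - h / 2 * m \<le> - 4 * L" using hK by linarith
qed

context set_matroid
begin

section \<open>Union bounds over independent sets\<close>

lemma not_upow_witness:
  assumes "0 < k" "S \<subseteq> {..<n}" "S \<inter> cl {} = {}" "S \<notin> upow k"
  shows "\<exists>J\<in>M - {{}}. k * card J < card (S \<inter> cl J)"
proof (rule ccontr)
  assume *: "\<not> ?thesis"
  have "card (S \<inter> cl J) \<le> k * card J" if "J \<in> M" for J
    using * that assms(3) by (cases "J = {}") (auto simp: not_less)
  then show False using matroid_covering[OF assms(1,2)] assms(4) by blast
qed

text \<open>By the covering theorem a failure is witnessed by a nonempty independent
  \<open>J\<close>; the empty one is excluded since \<open>f q\<close> contains no loops. The index
  type is free, so that both arrival orders and random subsets can be plugged in.\<close>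

lemma card_not_upow_le:
  fixes f :: "'b \<Rightarrow> nat set" and Q :: "'b set" and N y :: real
  assumes k: "0 < k" and Q: "finite Q"
    and f: "\<And>q. q \<in> Q \<Longrightarrow> f q \<subseteq> {..<n}" "\<And>q. q \<in> Q \<Longrightarrow> f q \<inter> cl {} = {}"
    and tail: "\<And>J. J \<in> M \<Longrightarrow> real (card {q \<in> Q. k * card J < card (f q \<inter> cl J)}) \<le> N * y ^ card J"
    and N: "0 \<le> N" and y: "0 \<le> y" "real n * y \<le> 1"
  shows "real (card {q \<in> Q. f q \<notin> upow k}) \<le> N * (2 * real n * y)"
proof -
  have finM: "finite M" by (rule finite_subset[of _ "Pow {..<n}"]) (use indep_ground in auto)
  have "{q \<in> Q. f q \<notin> upow k} \<subseteq> (\<Union>J\<in>M - {{}}. {q \<in> Q. k * card J < card (f q \<inter> cl J)})"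
    using not_upow_witness[OF k f] by blast
  then have "card {q \<in> Q. f q \<notin> upow k} \<le> card (\<Union>J\<in>M - {{}}. {q \<in> Q. k * card J < card (f q \<inter> cl J)})"
    using finM Q by (intro card_mono) auto
  also have "\<dots> \<le> (\<Sum>J\<in>M - {{}}. card {q \<in> Q. k * card J < card (f q \<inter> cl J)})"
    using finM by (intro card_UN_le) auto
  finally have "real (card {q \<in> Q. f q \<notin> upow k})
      \<le> (\<Sum>J\<in>M - {{}}. real (card {q \<in> Q. k * card J < card (f q \<inter> cl J)}))"
    by (simp only: of_nat_sum[symmetric] of_nat_le_iff)
  also have "\<dots> \<le> (\<Sum>J\<in>M - {{}}. N * y ^ card J)"
    by (rule sum_mono) (use tail in auto)
  also have "\<dots> \<le> (\<Sum>J\<in>Pow {..<n} - {{}}. N * y ^ card J)"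
    by (rule sum_mono2) (use indep_ground N y in auto)
  also have "\<dots> = N * (\<Sum>J\<in>Pow {..<n} - {{}}. y ^ card J)" by (simp add: sum_distrib_left)
  also have "\<dots> \<le> N * (2 * real n * y)"
    by (rule mult_left_mono[OF sum_power_card_nonempty_le[OF y] N])
  finally show ?thesis .
qed

lemma tentative_feasible:
  fixes e :: real
  assumes k: "0 < k" and n: "0 < n" and e: "0 \<le> e" "e \<le> 1"
    and B: "\<And>X. B X \<in> upow (nat \<lfloor>(1 - e) * real k * real (card X) / real n\<rfloor>)"
    and small: "real n * exp (- (e\<^sup>2 * real k / 4)) \<le> 1"
  shows "real (card {xs \<in> permutations_of_set {..<n}. tentative B {} xs \<notin> upow k})
    \<le> fact n * (2 * real n * exp (- (e\<^sup>2 * real k / 4)))"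
proof (rule card_not_upow_le[OF k])
  show "tentative B {} xs \<subseteq> {..<n}" if "xs \<in> permutations_of_set {..<n}" for xs
    using tentative_subset[of B "{}" xs] that by (auto simp: permutations_of_set_def)
  show "tentative B {} xs \<inter> cl {} = {}" for xs
    using tentativeD[of _ B "{}" xs] upow_disjoint_loops[OF B] by blast
  show "real (card {xs \<in> permutations_of_set {..<n}. k * card J < card (tentative B {} xs \<inter> cl J)})
    \<le> fact n * exp (- (e\<^sup>2 * real k / 4)) ^ card J" if J: "J \<in> M" for J
  proof -
    \<comment> \<open>The capacity of \<open>B Y\<close> is proportional to \<open>card Y\<close>,
      so the chance that a uniform element of \<open>Y\<close> is a hit in \<open>cl J\<close> is at
      most \<open>a\<close>, the same for all \<open>Y\<close>. Over \<open>n\<close> steps this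
      adds up to \<open>(1 - e) k card J\<close>.\<close>
    define a where "a = (1 - e) * real k * real (card J) / real n"
    have "real (card (Y \<inter> B Y \<inter> cl J)) \<le> a * real (card Y)" for Y
    proof -
      let ?x = "(1 - e) * real k * real (card Y) / real n"
      have "card (Y \<inter> B Y \<inter> cl J) \<le> card (B Y \<inter> cl J)"
        using finite_subset[OF upow_ground[OF B]] by (intro card_mono) auto
      also have "\<dots> \<le> nat \<lfloor>?x\<rfloor> * card J" by (rule upow_card_cl[OF B J])
      finally have "real (card (Y \<inter> B Y \<inter> cl J)) \<le> real (nat \<lfloor>?x\<rfloor>) * real (card J)"
        by (simp only: of_nat_mult[symmetric] of_nat_le_iff)
      also have "\<dots> \<le> ?x * real (card J)"
        using e by (intro mult_right_mono of_nat_floor) auto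
      also have "\<dots> = a * real (card Y)" by (simp add: a_def mult_ac)
      finally show ?thesis .
    qed
    then have "real (card {xs \<in> permutations_of_set {..<n}. k * card J < card (tentative B {} xs \<inter> cl J)})
      \<le> fact (card {..<n}) * exp ((exp (e / 2) - 1) * a * real (card {..<n}) - e / 2 * real (k * card J))"
      using e by (intro tentative_tail) (auto simp: a_def)
    also have "(exp (e / 2) - 1) * a * real (card {..<n}) - e / 2 * real (k * card J)
      = (exp (e / 2) - 1) * ((1 - e) * real (k * card J)) - e / 2 * real (k * card J)"
      using n by (simp add: a_def)
    also have "fact (card {..<n}) * exp \<dots> \<le> fact n * exp (- (e\<^sup>2 * real (k * card J) / 4))"
      using chernoff_exponent_le[OF e, of "real (k * card J)"] by simp
    also have "\<dots> = fact n * exp (- (e\<^sup>2 * real k / 4)) ^ card J"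
      by (simp add: exp_of_nat_mult[symmetric] mult_ac)
    finally show ?thesis .
  qed
qed (use small in auto)

text \<open>Dropping a lightest part loses at most the average part weight.\<close>

lemma upow_drop_part:
  fixes w :: "nat \<Rightarrow> real"
  assumes "S \<in> upow (Suc q)"
  shows "\<exists>T\<subseteq>S. T \<in> upow q \<and> real q * sum w S \<le> real (Suc q) * sum w T"
proof -
  obtain P where P: "\<And>l. l < Suc q \<Longrightarrow> P l \<in> M" "S = (\<Union>l<Suc q. P l)"
    and disj: "\<And>l l'. l < Suc q \<Longrightarrow> l' < Suc q \<Longrightarrow> l \<noteq> l' \<Longrightarrow> P l \<inter> P l' = {}"
    using upowE[OF assms] by blast
  obtain i where i: "i < Suc q" "\<And>l. l < Suc q \<Longrightarrow> sum w (P i) \<le> sum w (P l)"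
    using ex_min_if_finite[of "(\<lambda>l. sum w (P l)) ` {..<Suc q}"] by (auto simp: not_less)
  \<comment> \<open>The last part \<open>P q\<close> takes the freed index \<open>i\<close>. If
    \<open>i = q\<close>, nothing is moved.\<close>
  define T where "T = (\<Union>l<q. if l = i then P q else P l)"
  have ST: "S = T \<union> P i" "T \<inter> P i = {}"
  proof -
    show "S = T \<union> P i"
      using i(1) unfolding P(2) T_def by (auto simp: less_Suc_eq split: if_splits)
    show "T \<inter> P i = {}"
      using disj[of _ i] i(1) by (auto simp: T_def less_Suc_eq split: if_splits)
  qed
  have fin: "finite S" using upow_ground[OF assms] finite_subset by blast
  have sumS: "sum w S = sum w T + sum w (P i)"
    using ST fin by (metis finite_Un sum.union_disjoint)
  have "real (Suc q) * sum w (P i) = (\<Sum>l<Suc q. sum w (P i))" by simp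
  also have "\<dots> \<le> (\<Sum>l<Suc q. sum w (P l))" using i(2) by (intro sum_mono) auto
  also have "\<dots> = sum w S"
    unfolding P(2) using P(1) disj indep_finite by (intro sum.UNION_disjoint[symmetric]) auto
  finally have "real q * sum w S \<le> real (Suc q) * sum w T"
    unfolding sumS by (simp add: algebra_simps)
  moreover have "T \<in> upow q"
  proof (rule upowI[where P = "\<lambda>l. if l = i then P q else P l"])
    show "(\<Union>l<q. if l = i then P q else P l) = T" by (simp add: T_def)
    show "(if l = i then P q else P l) \<inter> (if l' = i then P q else P l') = {}"
      if "l < q" "l' < q" "l \<noteq> l'" for l l'
      using disj[of l l'] disj[of l q] disj[of q l'] that by auto
  qed (use P(1) in auto)
  ultimately show ?thesis using ST(1) by blast
qed

text \<open>Parts are dropped one at a time, and the retained fractions \<open>q / (q + 1)\<close>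
  telescope to \<open>q / k\<close>.\<close>

lemma upow_drop_parts:
  fixes w :: "nat \<Rightarrow> real"
  assumes "S \<in> upow k" "q \<le> k"
  shows "\<exists>T\<subseteq>S. T \<in> upow q \<and> real q * sum w S \<le> real k * sum w T"
  using assms(2)
proof (induction rule: inc_induct)
  case base
  then show ?case using assms(1) by blast
next
  case (step q)
  then obtain T where T: "T \<subseteq> S" "T \<in> upow (Suc q)" "real (Suc q) * sum w S \<le> real k * sum w T"
    by blast
  obtain T' where T': "T' \<subseteq> T" "T' \<in> upow q" "real q * sum w T \<le> real (Suc q) * sum w T'"
    using upow_drop_part[OF T(2)] by blast
  have "real (Suc q) * (real q * sum w S) = real q * (real (Suc q) * sum w S)" by (simp only: mult_ac)
  also have "\<dots> \<le> real q * (real k * sum w T)" by (rule mult_left_mono[OF T(3)]) simp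
  also have "\<dots> = real k * (real q * sum w T)" by (simp only: mult_ac)
  also have "\<dots> \<le> real k * (real (Suc q) * sum w T')" by (rule mult_left_mono[OF T'(3)]) simp
  also have "\<dots> = real (Suc q) * (real k * sum w T')" by (simp only: mult_ac)
  finally have "real q * sum w S \<le> real k * sum w T'"
    by (rule mult_left_le_imp_le) simp
  then show ?case using T T' by blast
qed

section \<open>Maximum-weight members of a union power\<close>

definition best :: "nat \<Rightarrow> (nat \<Rightarrow> real) \<Rightarrow> nat set \<Rightarrow> nat set" where
  "best j W X = (SOME T. T \<subseteq> X \<and> T \<in> upow j \<and>
     (\<forall>T'. T' \<subseteq> X \<longrightarrow> T' \<in> upow j \<longrightarrow> sum W T' \<le> sum W T))"

lemma best:
  shows best_subset: "best j W X \<subseteq> X" and best_upow: "best j W X \<in> upow j"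
    and best_max: "U \<subseteq> X \<Longrightarrow> U \<in> upow j \<Longrightarrow> sum W U \<le> sum W (best j W X)"
proof -
  let ?C = "{T. T \<subseteq> X \<and> T \<in> upow j}"
  have fin: "finite ?C" using finite_upow by (rule finite_subset[rotated]) auto
  have "?C \<noteq> {}" using empty_in_upow by blast
  then have "Max (sum W ` ?C) \<in> sum W ` ?C" using fin by (intro Max_in) auto
  then obtain T where T: "T \<in> ?C" "Max (sum W ` ?C) = sum W T" by blast
  then have "\<forall>T'\<in>?C. sum W T' \<le> sum W T" using Max_ge[of "sum W ` ?C"] fin by auto
  with T(1) have "\<exists>T. T \<subseteq> X \<and> T \<in> upow j \<and> (\<forall>T'. T' \<subseteq> X \<longrightarrow> T' \<in> upow j \<longrightarrow> sum W T' \<le> sum W T)"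
    by blast
  from someI_ex[OF this]
  show "best j W X \<subseteq> X" "best j W X \<in> upow j"
    "U \<subseteq> X \<Longrightarrow> U \<in> upow j \<Longrightarrow> sum W U \<le> sum W (best j W X)"
    unfolding best_def by blast+
qed

text \<open>Optimal sets may be tied, but the predicates describing them coincide for
  \<open>W\<close> and \<open>w\<close>, so \<open>SOME\<close> picks the same set.\<close>

lemma best_cong:
  assumes "\<And>i. i \<in> X \<Longrightarrow> W i = w i"
  shows "best j W X = best j w X"
proof -
  have eq: "sum W T = sum w T" if "T \<subseteq> X" for T
    using that assms by (intro sum.cong) auto
  have "(\<lambda>T. T \<subseteq> X \<and> T \<in> upow j \<and> (\<forall>T'. T' \<subseteq> X \<longrightarrow> T' \<in> upow j \<longrightarrow> sum W T' \<le> sum W T))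
    = (\<lambda>T. T \<subseteq> X \<and> T \<in> upow j \<and> (\<forall>T'. T' \<subseteq> X \<longrightarrow> T' \<in> upow j \<longrightarrow> sum w T' \<le> sum w T))"
    using eq by (intro ext) auto
  then show ?thesis unfolding best_def by simp
qed

text \<open>\<open>T\<close> has at most \<open>q * card J\<close> elements in \<open>cl J\<close>,
  so the exponent of the tail bound against the capacity \<open>m * card J\<close> scales with
  \<open>card J\<close>, as the union bound requires.\<close>

lemma sample_not_upow_le:
  assumes m: "0 < m" and n: "0 < n" and t: "t \<le> n" and T: "T \<in> upow q" and l: "0 \<le> l"
    and small: "real n * exp ((exp l - 1) * (real t / real n * real q) - l * real m) \<le> 1"
  shows "real (card {S \<in> subsets_card n t. S \<inter> T \<notin> upow m})
    \<le> real (n choose t) * (2 * real n * exp ((exp l - 1) * (real t / real n * real q) - l * real m))"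
proof (rule card_not_upow_le[OF m])
  show "S \<inter> T \<inter> cl {} = {}" for S using upow_disjoint_loops[OF T] by blast
  show "real (card {S \<in> subsets_card n t. m * card J < card (S \<inter> T \<inter> cl J)})
      \<le> real (n choose t) * exp ((exp l - 1) * (real t / real n * real q) - l * real m) ^ card J"
    if J: "J \<in> M" for J
  proof -
    have "real (card {S \<in> subsets_card n t. m * card J < card (S \<inter> (T \<inter> cl J))})
      \<le> real (n choose t) * exp ((exp l - 1) * (real t / real n) * real (card (T \<inter> cl J)) - l * real (m * card J))"
      using cl_ground by (intro subsets_card_tail l t n) auto
    also have "\<dots> \<le> real (n choose t) * exp ((exp l - 1) * (real t / real n) * real (q * card J) - l * real (m * card J))"
      using l of_nat_mono[OF upow_card_cl[OF T J], where 'a = real]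
      by (intro mult_left_mono iffD2[OF exp_le_cancel_iff] diff_right_mono) auto
    also have "\<dots> = real (n choose t) * exp ((exp l - 1) * (real t / real n * real q) - l * real m) ^ card J"
      by (simp add: exp_of_nat_mult[symmetric] algebra_simps)
    finally show ?thesis by (simp only: Int_assoc)
  qed
qed (use small in auto)

end

section \<open>Competitiveness\<close>

text \<open>Each term is at most \<open>2 (\<surd>t - \<surd>(t - 1))\<close>, and these differences
  telescope.\<close>

lemma sum_inverse_sqrt_le: "(\<Sum>t=1..n. 1 / sqrt (real t)) \<le> 2 * sqrt (real n)"
proof (induction n)
  case (Suc n)
  have pos: "0 < sqrt (real (Suc n))" by simp
  have "1 = (sqrt (real (Suc n)) - sqrt (real n)) * (sqrt (real (Suc n)) + sqrt (real n))"
    by (simp add: algebra_simps)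
  also have "\<dots> \<le> (sqrt (real (Suc n)) - sqrt (real n)) * (2 * sqrt (real (Suc n)))"
    by (intro mult_left_mono) auto
  finally have "1 / sqrt (real (Suc n)) \<le> 2 * (sqrt (real (Suc n)) - sqrt (real n))"
    by (simp only: pos_divide_le_eq[OF pos] mult_ac)
  then show ?case using Suc by simp
qed simp

lemma half_le_ln:
  assumes "2 \<le> n"
  shows "1 / 2 \<le> ln (real n)"
proof -
  have "exp (1 / 2) \<le> real n" using exp_bound_half[of "1 / 2 :: real"] assms by simp
  then show ?thesis using assms by (subst ln_ge_iff) auto
qed

lemma exp_neg_4_ln: "0 < n \<Longrightarrow> exp (- 4 * ln (real n)) = 1 / real n ^ 4"
  using exp_of_nat_mult[of 4 "ln (real n)"] by (simp add: exp_minus field_simps)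

lemma union_bound_failure:
  assumes "2 \<le> n"
  shows "2 * real n * (1 / real n ^ 4) \<le> 1 / (real n)\<^sup>2" "real n * (1 / real n ^ 4) \<le> 1"
proof -
  have n: "2 \<le> real n" using assms by simp
  have "2 * real n * (1 / real n ^ 4) = (2 / real n) * (1 / (real n)\<^sup>2)"
    by (simp add: power2_eq_square power4_eq_xxxx)
  also have "\<dots> \<le> 1 * (1 / (real n)\<^sup>2)"
    using n by (intro mult_right_mono) auto
  finally show 1: "2 * real n * (1 / real n ^ 4) \<le> 1 / (real n)\<^sup>2" by simp
  have "1 / (real n)\<^sup>2 \<le> 1" using n by simp
  moreover have "0 \<le> real n * (1 / real n ^ 4)" by simp
  ultimately show "real n * (1 / real n ^ 4) \<le> 1" using 1 by linarith
qed

context set_matroid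
begin

section \<open>Value of the rule against the optimum\<close>

lemma opt_upow:
  obtains T where "T \<in> upow k" "sum w T = opt (upow k) w"
    "\<And>S. S \<in> upow k \<Longrightarrow> sum w S \<le> opt (upow k) w"
proof -
  have fin: "finite (sum w ` upow k)" using finite_upow by simp
  have "opt (upow k) w \<in> sum w ` upow k"
    unfolding opt_def using empty_in_upow by (intro Max_in[OF fin]) auto
  moreover have "sum w S \<le> opt (upow k) w" if "S \<in> upow k" for S
    unfolding opt_def using that by (intro Max_ge[OF fin]) auto
  ultimately show ?thesis using that by (metis imageE)
qed

text \<open>The competitor is \<open>S \<inter> T\<close>, where \<open>T\<close> keeps the heaviest
  \<open>q\<close> parts of \<open>Z\<close>. Outside a \<open>1 / n\<^sup>2\<close> fraction of the
  samples it fits into the \<open>m\<close>-fold union. Thinning costs \<open>4 h\<close> and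
  failure costs \<open>1 / n\<close>, both relative to the mean.\<close>

lemma sample_value:
  fixes w :: "nat \<Rightarrow> real"
  defines "L \<equiv> ln (real n)"
  assumes n: "2 \<le> n" and k: "0 < k" and t: "1 \<le> t" "t \<le> n"
    and w: "\<And>i. i < n \<Longrightarrow> 0 \<le> w i" and Z: "Z \<in> upow k"
    and e: "e = 4 * sqrt (L / real k)" and m: "m = nat \<lfloor>(1 - e) * real k * real t / real n\<rfloor>"
    and h: "h = 4 * sqrt (L * real n / (real k * real t))"
  shows "real (n choose t) * (real t / real n) * (1 - 1 / real n - 4 * h) * sum w Z
    \<le> (\<Sum>S\<in>subsets_card n t. sum w (best m w S))"
proof -
  have wnn: "0 \<le> sum w S" if "S \<subseteq> {..<n}" for S
    using that w by (intro sum_nonneg) auto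
  have Z0: "0 \<le> sum w Z" using wnn upow_ground[OF Z] .
  have best0: "0 \<le> sum w (best m w S)" for S using wnn upow_ground[OF best_upow] .
  show ?thesis
  proof (cases "4 * h \<le> 1")
    \<comment> \<open>For such small \<open>t\<close> the claimed lower bound is not
      positive.\<close>
    case False
    have "real (n choose t) * (real t / real n) * (1 - 1 / real n - 4 * h) * sum w Z \<le> 0"
    proof (rule mult_nonpos_nonneg[OF mult_nonneg_nonpos Z0])
      have "0 \<le> 1 / real n" by simp
      then show "1 - 1 / real n - 4 * h \<le> 0" using False by linarith
    qed simp
    also have "0 \<le> (\<Sum>S\<in>subsets_card n t. sum w (best m w S))"
      by (rule sum_nonneg) (rule best0)
    finally show ?thesis .
  next
    case True
    define K where "K = real k * (real t / real n)"
    \<comment> \<open>Of the \<open>3 h\<close>, one \<open>h\<close> pays for \<open>e\<close>, one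
      for rounding \<open>m\<close> and one for the concentration gap. Rounding \<open>q\<close>
      costs a fourth, as \<open>1 \<le> h K \<le> h k\<close>.\<close>
    define q where "q = nat \<lfloor>real k * (1 - 3 * h)\<rfloor>"
    have n0: "0 < real n" "0 < n" using n by auto
    have tn: "real t / real n \<le> 1" "0 < real t / real n" using t n0 by auto
    have L: "1 / 2 \<le> L" unfolding L_def by (rule half_le_ln[OF n])
    have K: "0 < K" "K \<le> real k"
      unfolding K_def using k tn mult_left_mono[OF tn(1), of "real k"]
      by (simp_all only: mult_pos_pos of_nat_0_less_iff mult_1_right of_nat_0_le_iff)
    have hK: "h = 4 * sqrt (L / K)" unfolding h K_def by simp
    have h0: "0 \<le> h" using hK L K by simp
    have "L / real k \<le> L / K" using K L k by (intro divide_left_mono) auto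
    then have eh: "e \<le> h" unfolding e hK by simp
    have qk: "real q \<le> real k * (1 - 3 * h)"
      unfolding q_def using True h0 by (intro of_nat_floor mult_nonneg_nonneg) auto
    have "real k * (1 - 3 * h) \<le> real k" using h0 by (simp add: mult_left_le)
    then have "q \<le> k" using qk by linarith
    then obtain T where T: "T \<subseteq> Z" "T \<in> upow q" "real q * sum w Z \<le> real k * sum w T"
      using upow_drop_parts[OF Z] by blast
    have u: "real t / real n * real q \<le> K * (1 - 3 * h)"
      using mult_left_mono[OF qk, of "real t / real n"] tn by (simp add: K_def mult_ac)
    have mK: "(1 - e) * K - 1 \<le> real m"
      unfolding m K_def by (simp add: mult.assoc) linarith
    note exponent = sampling_exponent_le[OF L K(1) hK True eh mK u]
    define y where "y = exp ((exp (h / 2) - 1) * (real t / real n * real q) - h / 2 * real m)"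
    have y: "y \<le> 1 / real n ^ 4"
      using exponent(1) exp_neg_4_ln[OF n0(2)] unfolding y_def L_def[symmetric] by (metis exp_le_cancel_iff)
    have "real n * y \<le> real n * (1 / real n ^ 4)" using y by (intro mult_left_mono) auto
    then have ny: "real n * y \<le> 1" "2 * real n * y \<le> 1 / (real n)\<^sup>2"
      using union_bound_failure[OF n] by linarith+
    let ?bad = "{S \<in> subsets_card n t. S \<inter> T \<notin> upow m}"
    have "real (card ?bad) \<le> real (n choose t) * (2 * real n * y)"
      unfolding y_def using exponent(2) ny(1) h0
      by (intro sample_not_upow_le T(2) n0(2) t(2)) (auto simp: y_def)
    also have "\<dots> \<le> real (n choose t) * (1 / (real n)\<^sup>2)"
      using ny(2) by (intro mult_left_mono) auto
    finally have bad: "real (card ?bad) \<le> real (n choose t) * (1 / (real n)\<^sup>2)" .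
    have Tn: "T \<subseteq> {..<n}" using upow_ground[OF T(2)] .
    have finT: "finite T" using Tn finite_subset by blast
    have T0: "0 \<le> sum w T" using wnn[OF Tn] .
    have "real (n choose t) * (real t / real n) * sum w T - real (card ?bad) * sum w T
      = (\<Sum>S\<in>subsets_card n t. sum w (S \<inter> T)) - (\<Sum>S\<in>subsets_card n t. if S \<inter> T \<notin> upow m then sum w T else 0)"
      using subsets_card_sum_weights[OF Tn _ t(2), of w] t(1) by (simp add: sum.inter_filter[symmetric])
    also have "\<dots> = (\<Sum>S\<in>subsets_card n t. sum w (S \<inter> T) - (if S \<inter> T \<notin> upow m then sum w T else 0))"
      by (rule sum_subtractf[symmetric])
    also have "\<dots> \<le> (\<Sum>S\<in>subsets_card n t. sum w (best m w S))"
    proof (rule sum_mono)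
      fix S
      show "sum w (S \<inter> T) - (if S \<inter> T \<notin> upow m then sum w T else 0) \<le> sum w (best m w S)"
      proof (cases "S \<inter> T \<in> upow m")
        case True
        then show ?thesis using best_max[of "S \<inter> T" S m w] by simp
      next
        case False
        have "sum w (S \<inter> T) \<le> sum w T" using Tn w finT by (intro sum_mono2) auto
        then show ?thesis using False best0[of S] by simp
      qed
    qed
    finally have main: "real (n choose t) * (real t / real n) * sum w T - real (card ?bad) * sum w T
      \<le> (\<Sum>S\<in>subsets_card n t. sum w (best m w S))" .
    have "real k * (1 - 4 * h) \<le> real q"
    proof -
      have "1 \<le> h * real k" using exponent(3) mult_left_mono[OF K(2) h0] by linarith
      moreover have "real k * (1 - 3 * h) - 1 \<le> real q" unfolding q_def by linarith
      ultimately show ?thesis by (simp add: algebra_simps)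
    qed
    then have "real k * (1 - 4 * h) * sum w Z \<le> real q * sum w Z" using Z0 by (rule mult_right_mono)
    then have "real k * ((1 - 4 * h) * sum w Z) \<le> real k * sum w T" using T(3) by (simp add: mult.assoc)
    then have TZ: "(1 - 4 * h) * sum w Z \<le> sum w T" using k by simp
    have c0: "0 \<le> real (n choose t) * (real t / real n) * (1 - 1 / real n)"
      using n0 by (intro mult_nonneg_nonneg) auto
    have "(1 - 1 / real n - 4 * h) \<le> (1 - 1 / real n) * (1 - 4 * h)"
      using h0 n0 by (simp add: algebra_simps)
    then have "real (n choose t) * (real t / real n) * (1 - 1 / real n - 4 * h) * sum w Z
      \<le> real (n choose t) * (real t / real n) * ((1 - 1 / real n) * (1 - 4 * h)) * sum w Z"
      using Z0 by (intro mult_right_mono mult_left_mono) auto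
    also have "\<dots> = real (n choose t) * (real t / real n) * (1 - 1 / real n) * ((1 - 4 * h) * sum w Z)"
      by (simp only: mult_ac)
    also have "\<dots> \<le> real (n choose t) * (real t / real n) * (1 - 1 / real n) * sum w T"
      by (rule mult_left_mono[OF TZ c0])
    also have "\<dots> \<le> real (n choose t) * (real t / real n) * sum w T - real (n choose t) * (1 / (real n)\<^sup>2) * sum w T"
    proof -
      \<comment> \<open>Since \<open>t\<close> is at least 1, the failure probability is at most a
        \<open>1 / n\<close> share of the sampling rate \<open>t / n\<close>.\<close>
      have "1 / (real n)\<^sup>2 \<le> real t / real n * (1 / real n)"
        using t n0 by (simp add: power2_eq_square divide_right_mono)
      then have "real (n choose t) * (1 / (real n)\<^sup>2) * sum w T
          \<le> real (n choose t) * (real t / real n * (1 / real n)) * sum w T"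
        using T0 by (intro mult_right_mono mult_left_mono) auto
      then show ?thesis
        by (simp only: right_diff_distrib left_diff_distrib mult_1_right mult.assoc)
    qed
    also have "\<dots> \<le> real (n choose t) * (real t / real n) * sum w T - real (card ?bad) * sum w T"
      using mult_right_mono[OF bad T0] by simp
    finally show ?thesis using main by linarith
  qed
qed

text \<open>At time \<open>t\<close> the relative loss \<open>4 h\<close> equals
  \<open>16 \<surd>(L / k) \<surd>(n / t)\<close>. Averaged over \<open>t\<close> this is at most
  \<open>32 \<surd>(L / k)\<close>.\<close>

lemma mean_tentative_best_ge:
  fixes w :: "nat \<Rightarrow> real"
  defines "L \<equiv> ln (real n)"
  assumes n: "2 \<le> n" and k: "0 < k"
    and w: "\<And>i. i < n \<Longrightarrow> 0 \<le> w i" and Z: "Z \<in> upow k"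
    and e: "e = 4 * sqrt (L / real k)"
  shows "(1 - 1 / real n - 32 * sqrt (L / real k)) * sum w Z
    \<le> mean_tentative w (\<lambda>X. best (nat \<lfloor>(1 - e) * real k * real (card X) / real n\<rfloor>) w X) {..<n}"
proof -
  let ?B = "\<lambda>X. best (nat \<lfloor>(1 - e) * real k * real (card X) / real n\<rfloor>) w X"
  define s where "s = sqrt (L / real k)"
  have n0: "0 < real n" using n by simp
  have s0: "0 \<le> s" unfolding s_def L_def using n by simp
  have Z0: "0 \<le> sum w Z" using w upow_ground[OF Z] by (intro sum_nonneg) auto
  have summand: "(1 / real n) * (1 - 1 / real n - 16 * (s * sqrt (real n) * (1 / sqrt (real t)))) * sum w Z
      \<le> (\<Sum>S\<in>subsets_card n t. sum w (?B S)) / (real t * real (n choose t))" if t: "t \<in> {1..n}" for t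
  proof -
    have t': "1 \<le> t" "t \<le> n" "0 < real t" and c: "0 < real (n choose t)" using t by auto
    have h: "4 * sqrt (L * real n / (real k * real t)) = 4 * (s * sqrt (real n) * (1 / sqrt (real t)))"
      unfolding s_def by (simp add: real_sqrt_mult[symmetric] real_sqrt_divide[symmetric])
    have "(\<Sum>S\<in>subsets_card n t. sum w (?B S))
        = (\<Sum>S\<in>subsets_card n t. sum w (best (nat \<lfloor>(1 - e) * real k * real t / real n\<rfloor>) w S))"
      by (rule sum.cong) auto
    moreover have "real (n choose t) * (real t / real n) * (1 - 1 / real n - 16 * (s * sqrt (real n) * (1 / sqrt (real t)))) * sum w Z
      \<le> (\<Sum>S\<in>subsets_card n t. sum w (best (nat \<lfloor>(1 - e) * real k * real t / real n\<rfloor>) w S))"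
      using sample_value[OF n k t'(1,2) w Z e[unfolded L_def] refl refl] h unfolding L_def by simp
    ultimately show ?thesis
      using c t'(3) n0 by (simp add: pos_le_divide_eq mult_ac)
  qed
  have "(1 - 1 / real n - 32 * s) * sum w Z
    \<le> (1 - 1 / real n - 16 * (s * sqrt (real n) * (\<Sum>t=1..n. 1 / sqrt (real t))) / real n) * sum w Z"
  proof (rule mult_right_mono[OF _ Z0])
    have "s * sqrt (real n) * (\<Sum>t=1..n. 1 / sqrt (real t)) \<le> s * sqrt (real n) * (2 * sqrt (real n))"
      using s0 by (intro mult_left_mono sum_inverse_sqrt_le) auto
    also have "\<dots> = 2 * s * real n" by simp
    finally have "16 * (s * sqrt (real n) * (\<Sum>t=1..n. 1 / sqrt (real t))) / real n \<le> 32 * s"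
      using n0 by (simp add: pos_divide_le_eq)
    then show "1 - 1 / real n - 32 * s
      \<le> 1 - 1 / real n - 16 * (s * sqrt (real n) * (\<Sum>t=1..n. 1 / sqrt (real t))) / real n" by linarith
  qed
  also have "\<dots> = (\<Sum>t=1..n. (1 / real n) * (1 - 1 / real n - 16 * (s * sqrt (real n) * (1 / sqrt (real t)))) * sum w Z)"
  proof -
    have "(\<Sum>t=1..n. 1 - 1 / real n - 16 * (s * sqrt (real n) * (1 / sqrt (real t))))
      = real n * (1 - 1 / real n) - 16 * (s * sqrt (real n) * (\<Sum>t=1..n. 1 / sqrt (real t)))"
      by (simp only: sum_subtractf[of "\<lambda>_. 1 - 1 / real n"] sum_distrib_left[symmetric] sum_constant card_atLeastAtMost) simp
    then have "(1 / real n) * (\<Sum>t=1..n. 1 - 1 / real n - 16 * (s * sqrt (real n) * (1 / sqrt (real t))))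
      = 1 - 1 / real n - 16 * (s * sqrt (real n) * (\<Sum>t=1..n. 1 / sqrt (real t))) / real n"
      using n0 by (simp add: diff_divide_distrib right_diff_distrib)
    then show ?thesis by (simp only: sum_distrib_left[symmetric] sum_distrib_right[symmetric])
  qed
  also have "\<dots> \<le> (\<Sum>t=1..n. (\<Sum>S\<in>subsets_card n t. sum w (?B S)) / (real t * real (n choose t)))"
    by (rule sum_mono[OF summand])
  also have "\<dots> = mean_tentative w ?B {..<n}"
    by (rule mean_tentative_eq[symmetric]) (rule best_subset)
  finally show ?thesis unfolding s_def .
qed

text \<open>The set of all non-loops has at most \<open>n \<le> k\<close> elements, so it meets
  every constraint with \<open>J\<close> nonempty. It contains every feasible set, hence accepting
  it in full attains the optimum.\<close>

lemma competitive_large_k: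
  assumes k: "n \<le> k" "0 < k" and a: "a \<le> 1"
  shows "competitive n a (alg_of (\<lambda>_ _. {..<n} - cl {})) (upow k)"
  unfolding competitive_def
proof (intro allI impI)
  fix w :: "nat \<Rightarrow> real" assume w: "\<forall>i<n. 0 \<le> w i"
  let ?N = "{..<n} - cl {}"
  let ?F = "upow k" and ?R = "\<lambda>(_ :: nat \<Rightarrow> real) (_ :: nat set). ?N"
  have "?N \<in> ?F"
  proof (rule matroid_covering[OF k(2)])
    fix J assume J: "J \<in> M"
    show "card (?N \<inter> cl J) \<le> k * card J"
    proof (cases "J = {}")
      case False
      then have "1 \<le> card J" using indep_finite[OF J] by (simp add: Suc_le_eq card_gt_0_iff)
      have "card (?N \<inter> cl J) \<le> card {..<n}" by (intro card_mono) auto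
      also have "\<dots> \<le> k * 1" using k by simp
      also have "\<dots> \<le> k * card J" by (rule mult_le_mono2) fact
      finally show ?thesis .
    qed (simp add: Diff_Int_distrib2)
  qed simp
  moreover have tent: "tentative (\<lambda>_. ?N) X xs = set xs \<inter> ?N" for X and xs :: "nat list"
    by (induction xs arbitrary: X) auto
  ultimately have tentN: "tentative (?R w) {} xs = ?N" if "xs \<in> permutations_of_set {..<n}" for xs
    using that by (auto simp: permutations_of_set_def)
  have none: "{xs \<in> permutations_of_set {..<n}. tentative (?R w) {} xs \<notin> ?F} = {}"
    using tentN \<open>?N \<in> ?F\<close> by auto
  have mean: "mean_tentative w (?R w) {..<n} = sum w ?N"
    unfolding mean_tentative_def using tentN by simp
  have "expected_alg n (alg_of ?R) ?F w \<ge> mean_tentative w (?R w) {..<n}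
    - sum w ?N * (real (card {xs \<in> permutations_of_set {..<n}. tentative (?R w) {} xs \<notin> ?F}) / fact n)"
  proof (rule expected_alg_ge)
    show "S \<in> ?F" if "T \<in> ?F" "S \<subseteq> T" for T S using that by (rule upow_subset)
  qed (use w tentN in auto)
  then have E: "sum w ?N \<le> expected_alg n (alg_of ?R) ?F w" unfolding none mean by simp
  obtain T where T: "T \<in> ?F" "sum w T = opt ?F w" using opt_upow by blast
  have "T \<subseteq> ?N" using upow_ground[OF T(1)] upow_disjoint_loops[OF T(1)] by blast
  then have "opt ?F w \<le> sum w ?N" unfolding T(2)[symmetric] using w by (intro sum_mono2) auto
  moreover have "0 \<le> opt ?F w"
    unfolding T(2)[symmetric] using upow_ground[OF T(1)] w by (intro sum_nonneg) auto
  then have "a * opt ?F w \<le> 1 * opt ?F w" using a by (intro mult_right_mono)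
  ultimately show "a * opt ?F w \<le> expected_alg n (alg_of ?R) ?F w" using E by linarith
qed

text \<open>The constant is \<open>34 = 32 + 1 + 1\<close>: besides \<open>32 s\<close>, sampling
  failures and infeasible orders cost \<open>1 / n\<close> each, and \<open>1 / n \<le> s\<close>
  because \<open>k < n\<close>.\<close>

lemma competitive_best:
  fixes k :: nat
  defines "s \<equiv> sqrt (ln (real n) / real k)"
  assumes n: "2 \<le> n" and k: "0 < k" "k < n"
  shows "competitive n (1 - 34 * s)
    (alg_of (\<lambda>W X. best (nat \<lfloor>(1 - 4 * s) * real k * real (card X) / real n\<rfloor>) W X)) (upow k)"
  unfolding competitive_def
proof (intro allI impI)
  fix w :: "nat \<Rightarrow> real" assume w: "\<forall>i<n. 0 \<le> w i"
  define R where "R = (\<lambda>W X. best (nat \<lfloor>(1 - 4 * s) * real k * real (card X) / real n\<rfloor>) W X)"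
  let ?F = "upow k"
  obtain Z where Z: "Z \<in> ?F" "sum w Z = opt ?F w" and max: "\<And>S. S \<in> ?F \<Longrightarrow> sum w S \<le> opt ?F w"
    using opt_upow by blast
  have opt0: "0 \<le> opt ?F w" unfolding Z(2)[symmetric] using upow_ground[OF Z(1)] w by (intro sum_nonneg) auto
  have n0: "0 < real n" "0 < n" using n by auto
  have L: "1 / 2 \<le> ln (real n)" by (rule half_le_ln[OF n])
  have s0: "0 \<le> s" unfolding s_def using L by simp
  have s2: "s\<^sup>2 = ln (real n) / real k" unfolding s_def using L by simp
  have "(1 - 34 * s) * opt ?F w \<le> expected_alg n (alg_of R) ?F w"
  proof (cases "4 * s \<le> 1")
    case False
    have "(1 - 34 * s) * opt ?F w \<le> 0" using False opt0 by (intro mult_nonpos_nonneg) auto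
    also have "0 \<le> expected_alg n (alg_of R) ?F w"
      unfolding expected_alg_def using w
      by (intro divide_nonneg_nonneg sum_nonneg run_nonneg valid_alg_of) auto
    finally show ?thesis .
  next
    case True
    \<comment> \<open>Every selected element forms a feasible singleton, so the tentative weight
      never exceeds \<open>n\<close> times the optimum. This crude bound suffices against a failure
      probability of \<open>1 / n\<^sup>2\<close>.\<close>
    have weight: "w i \<le> opt ?F w" if i: "i \<in> T" "T \<in> upow j" for i T j
    proof -
      obtain P where P: "\<And>l. l < j \<Longrightarrow> P l \<in> M" "T = (\<Union>l<j. P l)" using upowE[OF i(2)] by blast
      then obtain l where "l < j" "i \<in> P l" using i(1) by auto
      then have "{i} \<in> M" using P(1) indep_subset by blast
      then have "{i} \<in> ?F"
        using k by (intro upowI[where P = "\<lambda>l. if l = 0 then {i} else {}"])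
          (auto simp: indep_empty split: if_splits)
      then show ?thesis using max by fastforce
    qed
    let ?bad = "{xs \<in> permutations_of_set {..<n}. tentative (R w) {} xs \<notin> ?F}"
    have x: "exp (- ((4 * s)\<^sup>2 * real k / 4)) = 1 / real n ^ 4"
      using exp_neg_4_ln[OF n0(2)] k by (simp add: power_mult_distrib s2)
    have "real (card ?bad) \<le> fact n * (2 * real n * exp (- ((4 * s)\<^sup>2 * real k / 4)))"
    proof (rule tentative_feasible)
      show "real n * exp (- ((4 * s)\<^sup>2 * real k / 4)) \<le> 1"
        unfolding x by (rule union_bound_failure(2)[OF n])
    qed (use k n0 s0 True in \<open>auto simp: R_def intro: best_upow\<close>)
    also have "\<dots> \<le> fact n * (1 / (real n)\<^sup>2)"
      unfolding x by (intro mult_left_mono union_bound_failure(1)[OF n]) simp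
    finally have bad: "real (card ?bad) / fact n \<le> 1 / (real n)\<^sup>2"
      by (simp add: pos_divide_le_eq mult.commute)
    have "expected_alg n (alg_of R) ?F w \<ge> mean_tentative w (R w) {..<n}
      - real n * opt ?F w * (real (card ?bad) / fact n)"
    proof (rule expected_alg_ge)
      show "R W X = R w X" if "\<And>i. i \<in> X \<Longrightarrow> W i = w i" for W X
        unfolding R_def using that by (rule best_cong)
      show "S \<in> ?F" if "T \<in> ?F" "S \<subseteq> T" for T S using that by (rule upow_subset)
      show "0 \<le> w i" if "i < n" for i using that w by simp
      fix xs assume xs: "xs \<in> permutations_of_set {..<n}"
      have "sum w (tentative (R w) {} xs) \<le> real (card (tentative (R w) {} xs)) * opt ?F w"
      proof (rule sum_bounded_above)
        fix i assume "i \<in> tentative (R w) {} xs"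
        then obtain Y where "i \<in> R w Y" using tentativeD[of i "R w" "{}" xs] by auto
        then show "w i \<le> opt ?F w" unfolding R_def by (rule weight[OF _ best_upow])
      qed
      also have "card (tentative (R w) {} xs) \<le> card {..<n}"
        using tentative_subset[of "R w" "{}" xs] xs by (intro card_mono) (auto simp: permutations_of_set_def)
      then have "real (card (tentative (R w) {} xs)) * opt ?F w \<le> real n * opt ?F w"
        using opt0 by (intro mult_right_mono) auto
      finally show "sum w (tentative (R w) {} xs) \<le> real n * opt ?F w" .
    qed
    moreover have "real n * opt ?F w * (real (card ?bad) / fact n) \<le> real n * opt ?F w * (1 / (real n)\<^sup>2)"
      using opt0 by (intro mult_left_mono bad) auto
    moreover have "real n * opt ?F w * (1 / (real n)\<^sup>2) = 1 / real n * opt ?F w"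
      using n0 by (simp add: power2_eq_square)
    moreover have "(1 - 1 / real n - 32 * s) * opt ?F w \<le> mean_tentative w (R w) {..<n}"
      using mean_tentative_best_ge[OF n k(1) _ Z(1) refl, of w] w unfolding R_def s_def Z(2) by simp
    moreover have "(1 - 34 * s) * opt ?F w \<le> (1 - 2 / real n - 32 * s) * opt ?F w"
    proof (rule mult_right_mono[OF _ opt0])
      have "(1 / real n)\<^sup>2 \<le> s\<^sup>2"
      proof -
        have "1 / real n \<le> 1 / real k" using k by (intro divide_left_mono) auto
        moreover have "1 / real n \<le> 1 / 2" using n by (intro divide_left_mono) auto
        moreover have "(1 / real n)\<^sup>2 = (1 / real n) * (1 / real n)" by (simp add: power2_eq_square)
        ultimately have "(1 / real n)\<^sup>2 \<le> (1 / 2) * (1 / real k)"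
          by (simp only: mult_mono zero_le_divide_1_iff of_nat_0_le_iff zero_le_numeral)
        also have "\<dots> \<le> ln (real n) * (1 / real k)" using L by (intro mult_right_mono) auto
        finally show ?thesis by (simp add: s2)
      qed
      then have "1 / real n \<le> s" using s0 by (rule power2_le_imp_le)
      then show "1 - 34 * s \<le> 1 - 2 / real n - 32 * s" by simp
    qed
    moreover have "(1 - 2 / real n - 32 * s) * opt ?F w
        = (1 - 1 / real n - 32 * s) * opt ?F w - 1 / real n * opt ?F w"
      by (simp add: algebra_simps)
    ultimately show ?thesis by linarith
  qed
  then show "(1 - 34 * s) * opt ?F w \<le> expected_alg n
    (alg_of (\<lambda>W X. best (nat \<lfloor>(1 - 4 * s) * real k * real (card X) / real n\<rfloor>) W X)) ?F w"
    unfolding R_def .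
qed

end

theorem theorem1:
  shows "\<exists>c>0. \<forall>n (M :: nat set set) (k :: nat). matroid n M \<longrightarrow> k > 0 \<longrightarrow>
           (\<exists>A. valid_alg A \<and>
                competitive n (1 - c * sqrt (ln (real n) / real k)) A (matroid_union_pow M k))"
proof (intro exI[of _ 34] conjI allI impI)
  fix n k :: nat and M :: "nat set set"
  assume M: "matroid n M" and k: "k > 0"
  interpret set_matroid n M by standard (rule M)
  show "\<exists>A. valid_alg A \<and>
      competitive n (1 - 34 * sqrt (ln (real n) / real k)) A (matroid_union_pow M k)"
  proof (cases "n \<le> k")
    case True
    \<comment> \<open>This covers \<open>n = 0\<close> too, by the convention
      \<open>ln 0 = 0\<close>. The cases \<open>n \<le> 1\<close> fall under
      \<open>n \<le> k\<close>, so the other case has \<open>n \<ge> 2\<close>.\<close>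
    have "0 \<le> ln (real n)" by (cases "n = 0") auto
    then have "1 - 34 * sqrt (ln (real n) / real k) \<le> 1" by simp
    then show ?thesis using competitive_large_k[OF True k] valid_alg_of by blast
  next
    case False
    then have "2 \<le> n" "k < n" using k by auto
    then show ?thesis using competitive_best[OF _ k] valid_alg_of by blast
  qed
qed simp

end
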